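(* Let $(K,v)$ be a valued field and let $w$ be an extension of $v$ to $K(X)$. If $\{Q_i\}_{i\in\Delta}$ is an induced complete sequence of ABKPs for $w$ (with $\Delta=\bigcup_{j\in I}\Delta_j$ and $\Delta_j=\{j\}\cup\vartheta_j$) such that $\Delta$ has no last element, then $w$ falls in exactly one of the following two cases. (i) After a finite number, say, $r$ of augmentation steps, it is the stable limit of a continuous family $\mathcal{W}_r$ of augmentations of $w_r$ $$w_0\xrightarrow{Q_1,\gamma_1} w_1\xrightarrow{Q_2,\gamma_2}\cdots \longrightarrow w_{r-1}\xrightarrow{Q_r,\gamma_r} w_r\xrightarrow{\mathcal{W}_r}\rho_{\mathcal{W}_r}=w,$$ such that $\deg(\Phi(w_r,w))=\deg(w_r)$ and $Q_r\notin\Phi(w_r,w)$. (ii) It is the stable limit of a complete infinite MacLane-Vaquié chain $$w_0\xrightarrow{Q_1,\gamma_1} w_1\xrightarrow{Q_2,\gamma_2}\cdots \longrightarrow w_{n}\xrightarrow{Q_{n+1},\gamma_{n+1}} w_{n+1}\longrightarrow\cdots .$$ In both cases, $\gamma_j=w(Q_j)$ for all $j\in I$. Also, an augmentation $w_j\longrightarrow w_{j+1}$ is ordinary if and only if $\vartheta_j=\emptyset$.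
   Context: **Setting.** $(K,v)$ is a valued field of arbitrary rank with value group $\Gamma_v$; $\bar v$ is a fixed extension of $v$ to an algebraic closure $\overline K$ of $K$. Value groups are totally ordered abelian groups; $\Gamma_w$ is the value group of $w$. **Abstract key polynomials.** For a valuation $w$ on $K(X)$ let $\overline w$ be a common extension of $w$ and $\bar v$ to $\overline K(X)$. For nonconstant $f\in K[X]$ put $\delta(f)=\max\{\overline w(X-\alpha)\mid f(\alpha)=0\}$ (independent of the choice of $\overline w$). A monic nonconstant $Q\in K[X]$ is an abstract key polynomial (ABKP) for $w$ if $\delta(f)<\delta(Q)$ for every nonconstant $f\in K[X]$ with $\deg f<\deg Q$. The $Q$-truncation of $w$ is $w_Q(f)=\min_{i\ge0}w(f_iQ^i)$, where $f=\sum_{i\ge 0} f_iQ^i$, $\deg f_i<\deg Q$, is the $Q$-expansion of $f$; if $Q$ is an ABKP for $w$, then $w_Q$ is a valuation on $K(X)$. **Complete sequences.** A family $\{Q_i\}_{i\in\Delta}$ of ABKPs for $w$ is a complete sequence of ABKPs for $w$ if: $\delta(Q_i)\ne\delta(Q_j)$ for $i\ne j$; it is well-ordered with respect to the ordering $Q_i<Q_j\iff\delta(Q_i)<\delta(Q_j)$, for $i<j$ in $\Delta$; and for every nonconstant $f\in K[X]$ there is some $Q_i$ in the family with $\deg Q_i\le\deg f$ and $w_{Q_i}(f)=w(f)$. It is an induced complete sequence if moreover: (1) $\Delta=\bigcup_{j\in I}\Delta_j$ with $I=\{0,1,\dots,N\}$ or $I=\mathbb N\cup\{0\}$, and for each $j\in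 I$, $\Delta_j=\{j\}\cup\vartheta_j$, where $\vartheta_j$ is an ordered set without a last element or is empty; (2) $\deg Q_0=1$; (3) for all $j\in I\setminus\{0\}$, $j-1<i<j$ for all $i\in\vartheta_{j-1}$ (and if $I=\{0,\dots,N\}$, then $N<i$ for $i\in\vartheta_N$); (4) all $Q_i$ with $i\in\Delta_j$ have the same degree, strictly less than the degree of $Q_{i'}$ for every $i'\in\Delta_{j+1}$; (5) for $i<i'$ in $\Delta$, $w(Q_i)<w(Q_{i'})$ and $\delta(Q_i)<\delta(Q_{i'})$. **Key polynomials.** For a valuation $w$ on $K(X)$: $f\sim_w g$ means $w(f-g)>w(f)=w(g)$; $f\mid_w g$ means $g\sim_w fh$ for some $h\in K[X]$; $f$ is $w$-irreducible if $f\mid_w hq$ implies $f\mid_w h$ or $f\mid_w q$; $f$ is $w$-minimal if $f\mid_w h$, $h\neq0$, implies $\deg h\ge\deg f$. A monic nonconstant $f\in K[X]$ is a key polynomial for $w$ if it is $w$-irreducible and $w$-minimal; $\mathrm{KP}(w)$ is the set of these. If $\mathrm{KP}(w)\neq\emptyset$, $\deg(w)$ is the minimal degree of a key polynomial for $w$. For a valuation $w'$ on $K(X)$ taking values in a subgroup of $\Gamma_w$, write $w'\le w$ if $w'(f)\le w(f)$ for all $f\in K[X]$, and $w'<w$ if also $w'\ne w$. If $w'<w$, $\Phi(w',w)$ is the set of all monic polynomials $g\in K[X]$ of minimal degree $d$ such that $w'(g)<w(g)$, and $\deg(\Phi(w',w))=d$. **Ordinary augmentation.** For $\phi\in\mathrm{KP}(w')$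 and $\gamma>w'(\phi)$ in a totally ordered abelian group containing $\Gamma_{w'}$ as an ordered subgroup, $[w';\phi,\gamma]$ is the valuation $f\mapsto\min_{i\ge0}\{w'(f_i)+i\gamma\}$, where $f=\sum f_i\phi^i$, $\deg f_i<\deg\phi$, is the $\phi$-expansion. **Continuous families and stable limits.** A continuous family of augmentations of $w'$ (a valuation on $K(X)$ admitting key polynomials) is a family $\mathcal W=(\rho_i=[w';\chi_i,\gamma_i])_{i\in\mathbf A}$ of ordinary augmentations of $w'$, indexed by a totally ordered set $\mathbf A$ with $\gamma_i<\gamma_j$ for $i<j$, such that: $\mathbf A$ has no last element; all $\chi_i\in\mathrm{KP}(w')$ have the same degree, denoted $\deg(\mathcal W)$; for all $i<j$, $\chi_j$ is a key polynomial for $\rho_i$, $\chi_j\not\sim_{\rho_i}\chi_i$ and $\rho_j=[\rho_i;\chi_j,\gamma_j]$. For a totally ordered family $\mathcal W=(\rho_i)_{i\in\mathbf A}$ of valuations on $K(X)$ with values in a common ordered group, $f\in K[X]$ is $\mathcal W$-stable if for some $i_0\in\mathbf A$, $\rho_i(f)=\rho_{i_0}(f)$ for all $i\ge i_0$; this stable value is denoted $\rho_{\mathcal W}(f)$. Otherwise $f$ is $\mathcal W$-unstable. If all polynomials are $\mathcal W$-stable, the valuation $\rho_{\mathcal W}$ is called the stable limit of $\mathcal W$. Let $m_\infty$ be the minimal degree of a $\mathcal W$-unstable polynomial ($\infty$ if there is none). A continuous family is essential if $\deg(\mathcal W)<m_\infty<\infty$. $\mathrm{KP}_\infty(\mathcal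 W)$ is the set of monic $\mathcal W$-unstable polynomials of minimal degree (MacLane-Vaquié limit key polynomials). **Limit augmentation.** For an essential continuous family $\mathcal W=(\rho_i)_{i\in\mathbf A}$ of augmentations of $w'$, $Q\in\mathrm{KP}_\infty(\mathcal W)$ and $\gamma>\rho_i(Q)$ for all $i$, in a totally ordered abelian group containing the common value group of the $\rho_i$, $[\mathcal W;Q,\gamma]$ is the valuation $f\mapsto\min_{i\ge0}\{\rho_{\mathcal W}(f_i)+i\gamma\}$, where $f=\sum f_iQ^i$, $\deg f_i<\deg Q$, is the $Q$-expansion. **Augmentation steps and MacLane-Vaquié chains.** An augmentation step $w_n\xrightarrow{\phi_{n+1},\gamma_{n+1}}w_{n+1}$ is either ordinary, $w_{n+1}=[w_n;\phi_{n+1},\gamma_{n+1}]$ with $\phi_{n+1}\in\mathrm{KP}(w_n)$, or limit, $w_{n+1}=[\mathcal W_n;\phi_{n+1},\gamma_{n+1}]$ with $\mathcal W_n$ an essential continuous family of augmentations of $w_n$ and $\phi_{n+1}\in\mathrm{KP}_\infty(\mathcal W_n)$. The arrow $w_r\xrightarrow{\mathcal W_r}\rho_{\mathcal W_r}$ denotes passage to the stable limit of a continuous family $\mathcal W_r$ of augmentations of $w_r$. For a finite or countably infinite chain $w_0\xrightarrow{\phi_1,\gamma_1}w_1\xrightarrow{\phi_2,\gamma_2}\cdots$ of such steps, let $\phi_0\in\mathrm{KP}(w_0)$ be of minimal degree and $\gamma_0=w_0(\phi_0)$. The chain is a MacLane-Vaquié chain if for every ordinary step $\deg(w_n)<\deg(\Phi(w_n,w_{n+1}))$,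 and for every limit step $\deg(w_n)=\deg(\Phi(w_n,w_{n+1}))$ and $\phi_n\notin\Phi(w_n,w_{n+1})$. It is complete if $w_0$ is a depth zero valuation, i.e. there are $\alpha\in K$ and an element $\epsilon$ of a totally ordered abelian group containing $\Gamma_v$ with $w_0(\sum c_i(X-\alpha)^i)=\min_i\{v(c_i)+i\epsilon\}$ ($c_i\in K$). An infinite MacLane-Vaquié chain has a stable limit, namely that of the family $(w_n)_{n\ge0}$. *)

theory Defs
  imports
    "HOL-Algebra.Algebraic_Closure_Type"
    "HOL-Library.Extended"
    "HOL-Library.Extended_Nat"
begin

hide_const (open) Polynomials.degree

section \<open>Valuations\<close>

text \<open>
  Valuations are written additively, with values in a totally ordered abelian group 'g extended by
  \<open>Pinf\<close>; the element \<open>Minf\<close> of the type \<open>extended\<close> is never attained. The type 'g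
  is an arbitrary ambient group, large enough for all valuations considered together (also those on
  the algebraic closure); the value group proper is \<open>val_group\<close>.
\<close>

definition valuation :: "('k::field \<Rightarrow> 'g::linordered_ab_group_add extended) \<Rightarrow> bool" where
  "valuation v \<longleftrightarrow>
     (\<forall>x. v x = Pinf \<longleftrightarrow> x = 0) \<and> (\<forall>x. v x \<noteq> Minf) \<and>
     (\<forall>x y. v (x * y) = v x + v y) \<and> (\<forall>x y. min (v x) (v y) \<le> v (x + y))"

definition val_group :: "('k::field \<Rightarrow> 'g::linordered_ab_group_add extended) \<Rightarrow> 'g set" where
  "val_group v = {g. \<exists>x. x \<noteq> 0 \<and> v x = Fin g}"

definition nmult :: "nat \<Rightarrow> 'g::comm_monoid_add \<Rightarrow> 'g" where
  "nmult i \<gamma> = (\<Sum>k<i. \<gamma>)"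

type_synonym ('a, 'g) ratval = "'a poly fract \<Rightarrow> 'g extended"

definition to_rat :: "'a::field poly \<Rightarrow> 'a poly fract" where
  "to_rat f = Fraction_Field.Fract f 1"

definition extends_to_rat ::
  "('a::field \<Rightarrow> 'g extended) \<Rightarrow> ('a, 'g::linordered_ab_group_add) ratval \<Rightarrow> bool" where
  "extends_to_rat v w \<longleftrightarrow> valuation w \<and> (\<forall>a. w (to_rat [:a:]) = v a)"

definition common_extension ::
  "('a alg_closure \<Rightarrow> 'g extended) \<Rightarrow> ('a::field, 'g::linordered_ab_group_add) ratval
    \<Rightarrow> ('a alg_closure, 'g) ratval \<Rightarrow> bool" where
  "common_extension vbar w wbar \<longleftrightarrow> extends_to_rat vbar wbar \<and>
     (\<forall>p q. q \<noteq> 0 \<longrightarrow>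
        wbar (Fraction_Field.Fract (map_poly to_ac p) (map_poly to_ac q)) =
        w (Fraction_Field.Fract p q))"

section \<open>Expansions and truncations\<close>

text \<open>The \<open>i\<close>-th digit of the \<open>Q\<close>-expansion of \<open>f\<close>; see \<open>expansion\<close> and \<open>expansion_unique\<close> below.\<close>

definition exp_coeff :: "'a::field poly \<Rightarrow> 'a poly \<Rightarrow> nat \<Rightarrow> 'a poly" where
  "exp_coeff Q f i = (f div Q ^ i) mod Q"

lemma degree_exp_coeff:
  assumes "Polynomial.degree Q > 0"
  shows "Polynomial.degree (exp_coeff Q f i) < Polynomial.degree Q"
  using assms degree_mod_less'[of Q] unfolding exp_coeff_def
  by (metis degree_0 degree_mod_less less_irrefl)

lemma exp_coeff_eq_0:
  assumes "Polynomial.degree Q > 0" and "i > Polynomial.degree f"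
  shows "exp_coeff Q f i = 0"
proof -
  have "Q \<noteq> 0" using assms by auto
  have "Polynomial.degree f < i * 1" using assms(2) by simp
  also have "\<dots> \<le> i * Polynomial.degree Q" using assms(1) by (intro mult_le_mono) auto
  finally have "Polynomial.degree f < Polynomial.degree (Q ^ i)"
    using \<open>Q \<noteq> 0\<close> by (simp add: degree_power_eq)
  then show ?thesis by (simp add: exp_coeff_def div_poly_less)
qed

lemma expansion:
  assumes "Polynomial.degree Q > 0"
  shows "f = (\<Sum>i\<le>Polynomial.degree f. exp_coeff Q f i * Q ^ i)"
proof -
  have *: "f = (\<Sum>i<n. exp_coeff Q f i * Q ^ i) + (f div Q ^ n) * Q ^ n" for n
  proof (induction n)
    case (Suc n)
    have "f div Q ^ n = (f div Q ^ n) mod Q + (f div Q ^ Suc n) * Q"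
      by (metis add.commute div_mult_mod_eq poly_div_mult_right power_Suc2)
    then have "(f div Q ^ n) * Q ^ n = exp_coeff Q f n * Q ^ n + (f div Q ^ Suc n) * Q ^ Suc n"
      unfolding exp_coeff_def by (metis distrib_right mult.assoc power_Suc)
    then show ?case using Suc by (simp add: add.assoc)
  qed simp
  have "Q \<noteq> 0" using assms by auto
  have "Polynomial.degree f < Suc (Polynomial.degree f) * 1" by simp
  also have "\<dots> \<le> Suc (Polynomial.degree f) * Polynomial.degree Q"
    using assms by (intro mult_le_mono) auto
  also have "\<dots> = Polynomial.degree (Q ^ Suc (Polynomial.degree f))"
    by (rule degree_power_eq[OF \<open>Q \<noteq> 0\<close>, symmetric])
  finally have "Polynomial.degree f < Polynomial.degree (Q ^ Suc (Polynomial.degree f))" .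
  then have "f div Q ^ Suc (Polynomial.degree f) = 0" by (rule div_poly_less)
  then show ?thesis
    using *[of "Suc (Polynomial.degree f)"] by (simp del: power_Suc sum.lessThan_Suc add: lessThan_Suc_atMost)
qed

lemma expansion_unique:
  assumes "f = (\<Sum>i\<le>n. c i * Q ^ i)"
    and "\<And>i. i \<le> n \<Longrightarrow> Polynomial.degree (c i) < Polynomial.degree Q" and "i \<le> n"
  shows "exp_coeff Q f i = c i"
  using assms
proof (induction n arbitrary: f c i)
  case 0
  then show ?case by (simp add: exp_coeff_def mod_poly_less)
next
  case (Suc n)
  define g where "g = (\<Sum>i\<le>n. c (Suc i) * Q ^ i)"
  have f: "f = c 0 + g * Q"
    unfolding Suc.prems(1) g_def
    by (subst sum.atMost_Suc_shift) (simp add: sum_distrib_right mult.assoc power_commutes)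
  have c0: "Polynomial.degree (c 0) < Polynomial.degree Q" using Suc.prems(2) by simp
  then have Q: "Q \<noteq> 0" by auto
  show ?case
  proof (cases i)
    case 0
    then show ?thesis using c0 by (simp add: exp_coeff_def f mod_poly_less)
  next
    case (Suc j)
    have "f div Q = g" using c0 Q by (simp add: f div_poly_less)
    then have "exp_coeff Q f i = exp_coeff Q g j"
      by (simp add: exp_coeff_def Suc poly_div_mult_right)
    also have "\<dots> = c (Suc j)"
      by (rule Suc.IH[OF g_def]) (use Suc Suc.prems in auto)
    finally show ?thesis using Suc by simp
  qed
qed

text \<open>
  The minima over all digits are taken over \<open>i \<le> degree f\<close>: the remaining digits vanish and
  contribute \<open>Pinf\<close>.
\<close>

definition truncation ::
  "('a::field, 'g::linordered_ab_group_add) ratval \<Rightarrow> 'a poly \<Rightarrow> 'a poly \<Rightarrow> 'g extended" where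
  "truncation w Q f =
     Min ((\<lambda>i. w (to_rat (exp_coeff Q f i * Q ^ i))) ` {..Polynomial.degree f})"

text \<open>
  \<open>is_augmentation u \<phi> \<gamma> w\<close>: \<open>w\<close> is the valuation on \<open>K(X)\<close> determined by
  \<open>f \<mapsto> min {u f\<^sub>i + i \<gamma>}\<close> on \<open>K[X]\<close>, where \<open>u\<close> is a function on \<open>K[X]\<close>.
\<close>

definition is_augmentation ::
  "('a::field poly \<Rightarrow> 'g extended) \<Rightarrow> 'a poly \<Rightarrow> 'g
    \<Rightarrow> ('a, 'g::linordered_ab_group_add) ratval \<Rightarrow> bool" where
  "is_augmentation u \<phi> \<gamma> w \<longleftrightarrow> valuation w \<and>
     (\<forall>f. w (to_rat f) =
        Min ((\<lambda>i. u (exp_coeff \<phi> f i) + Fin (nmult i \<gamma>)) ` {..Polynomial.degree f}))"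

section \<open>Abstract key polynomials and complete sequences\<close>

definition delta ::
  "('a alg_closure, 'g::linordered_ab_group_add) ratval \<Rightarrow> 'a::field poly \<Rightarrow> 'g extended" where
  "delta wbar f = Max {wbar (to_rat [:- \<alpha>, 1:]) | \<alpha>. poly (map_poly to_ac f) \<alpha> = 0}"

definition abkp ::
  "('a alg_closure, 'g::linordered_ab_group_add) ratval \<Rightarrow> 'a::field poly \<Rightarrow> bool" where
  "abkp wbar Q \<longleftrightarrow> lead_coeff Q = 1 \<and> Polynomial.degree Q > 0 \<and>
     (\<forall>f. 0 < Polynomial.degree f \<and> Polynomial.degree f < Polynomial.degree Q
        \<longrightarrow> delta wbar f < delta wbar Q)"

definition complete_seq ::
  "('a, 'g) ratval \<Rightarrow> ('a alg_closure, 'g::linordered_ab_group_add) ratval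
    \<Rightarrow> 'i::linorder set \<Rightarrow> ('i \<Rightarrow> 'a::field poly) \<Rightarrow> bool" where
  "complete_seq w wbar D Q \<longleftrightarrow>
     (\<forall>i\<in>D. abkp wbar (Q i)) \<and>
     (\<forall>i\<in>D. \<forall>j\<in>D. i \<noteq> j \<longrightarrow> delta wbar (Q i) \<noteq> delta wbar (Q j)) \<and>
     (\<forall>i\<in>D. \<forall>j\<in>D. i < j \<longrightarrow> delta wbar (Q i) < delta wbar (Q j)) \<and>
     (\<forall>S\<subseteq>D. S \<noteq> {} \<longrightarrow> (\<exists>i\<in>S. \<forall>j\<in>S. delta wbar (Q i) \<le> delta wbar (Q j))) \<and>
     (\<forall>f. Polynomial.degree f > 0 \<longrightarrow>
        (\<exists>i\<in>D. Polynomial.degree (Q i) \<le> Polynomial.degree f \<and>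
          truncation w (Q i) f = w (to_rat f)))"

text \<open>
  The index set \<open>D\<close> lives in an arbitrary linearly ordered type; \<open>c j\<close> is the index which plays
  the role of the natural number \<open>j \<in> I\<close>, so that \<open>D\<close> is the union of the blocks
  \<open>{c j} \<union> \<theta> j\<close>.
\<close>

definition block :: "(nat \<Rightarrow> 'i) \<Rightarrow> (nat \<Rightarrow> 'i set) \<Rightarrow> nat \<Rightarrow> 'i set" where
  "block c \<theta> j = {c j} \<union> \<theta> j"

definition induced_complete_seq ::
  "('a, 'g) ratval \<Rightarrow> ('a alg_closure, 'g::linordered_ab_group_add) ratval
    \<Rightarrow> 'i::linorder set \<Rightarrow> ('i \<Rightarrow> 'a::field poly)
    \<Rightarrow> nat set \<Rightarrow> (nat \<Rightarrow> 'i) \<Rightarrow> (nat \<Rightarrow> 'i set) \<Rightarrow> bool" where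
  "induced_complete_seq w wbar D Q I c \<theta> \<longleftrightarrow>
     complete_seq w wbar D Q \<and>
     (I = UNIV \<or> (\<exists>N. I = {..N})) \<and>
     strict_mono_on I c \<and>
     D = (\<Union>j\<in>I. block c \<theta> j) \<and>
     (\<forall>j\<in>I. \<forall>i\<in>\<theta> j. \<exists>i'\<in>\<theta> j. i < i') \<and>
     Polynomial.degree (Q (c 0)) = 1 \<and>
     (\<forall>j. Suc j \<in> I \<longrightarrow> (\<forall>i\<in>\<theta> j. c j < i \<and> i < c (Suc j))) \<and>
     (\<forall>N. I = {..N} \<longrightarrow> (\<forall>i\<in>\<theta> N. c N < i)) \<and>
     (\<forall>j\<in>I. \<forall>i\<in>block c \<theta> j. \<forall>i'\<in>block c \<theta> j.
        Polynomial.degree (Q i) = Polynomial.degree (Q i')) \<and>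
     (\<forall>j. Suc j \<in> I \<longrightarrow> (\<forall>i\<in>block c \<theta> j. \<forall>i'\<in>block c \<theta> (Suc j).
        Polynomial.degree (Q i) < Polynomial.degree (Q i'))) \<and>
     (\<forall>i\<in>D. \<forall>i'\<in>D. i < i' \<longrightarrow>
        w (to_rat (Q i)) < w (to_rat (Q i')) \<and> delta wbar (Q i) < delta wbar (Q i'))"

section \<open>Key polynomials\<close>

definition val_equiv ::
  "('a::field, 'g::linordered_ab_group_add) ratval \<Rightarrow> 'a poly \<Rightarrow> 'a poly \<Rightarrow> bool" where
  "val_equiv w f g \<longleftrightarrow> w (to_rat (f - g)) > w (to_rat f) \<and> w (to_rat f) = w (to_rat g)"

definition val_dvd ::
  "('a::field, 'g::linordered_ab_group_add) ratval \<Rightarrow> 'a poly \<Rightarrow> 'a poly \<Rightarrow> bool" where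
  "val_dvd w f g \<longleftrightarrow> (\<exists>h. val_equiv w g (f * h))"

definition val_irreducible ::
  "('a::field, 'g::linordered_ab_group_add) ratval \<Rightarrow> 'a poly \<Rightarrow> bool" where
  "val_irreducible w f \<longleftrightarrow> (\<forall>h q. val_dvd w f (h * q) \<longrightarrow> val_dvd w f h \<or> val_dvd w f q)"

definition val_minimal ::
  "('a::field, 'g::linordered_ab_group_add) ratval \<Rightarrow> 'a poly \<Rightarrow> bool" where
  "val_minimal w f \<longleftrightarrow>
     (\<forall>h. val_dvd w f h \<and> h \<noteq> 0 \<longrightarrow> Polynomial.degree f \<le> Polynomial.degree h)"

definition KP :: "('a::field, 'g::linordered_ab_group_add) ratval \<Rightarrow> 'a poly set" where
  "KP w = {f. lead_coeff f = 1 \<and> Polynomial.degree f > 0 \<and> val_irreducible w f \<and> val_minimal w f}"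

definition deg_val :: "('a::field, 'g::linordered_ab_group_add) ratval \<Rightarrow> nat" where
  "deg_val w = (LEAST d. \<exists>f\<in>KP w. Polynomial.degree f = d)"

definition val_le ::
  "('a::field, 'g::linordered_ab_group_add) ratval \<Rightarrow> ('a, 'g) ratval \<Rightarrow> bool" where
  "val_le w' w \<longleftrightarrow> val_group w' \<subseteq> val_group w \<and> (\<forall>f. w' (to_rat f) \<le> w (to_rat f))"

definition val_less ::
  "('a::field, 'g::linordered_ab_group_add) ratval \<Rightarrow> ('a, 'g) ratval \<Rightarrow> bool" where
  "val_less w' w \<longleftrightarrow> val_le w' w \<and> w' \<noteq> w"

definition deg_Phi ::
  "('a::field, 'g::linordered_ab_group_add) ratval \<Rightarrow> ('a, 'g) ratval \<Rightarrow> nat" where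
  "deg_Phi w' w = (LEAST d. \<exists>g. lead_coeff g = 1 \<and> w' (to_rat g) < w (to_rat g) \<and>
     Polynomial.degree g = d)"

definition Phi ::
  "('a::field, 'g::linordered_ab_group_add) ratval \<Rightarrow> ('a, 'g) ratval \<Rightarrow> 'a poly set" where
  "Phi w' w = {g. lead_coeff g = 1 \<and> w' (to_rat g) < w (to_rat g) \<and>
     Polynomial.degree g = deg_Phi w' w}"

section \<open>Augmentations\<close>

definition ordinary_aug ::
  "('a::field, 'g::linordered_ab_group_add) ratval \<Rightarrow> 'a poly \<Rightarrow> 'g \<Rightarrow> ('a, 'g) ratval \<Rightarrow> bool" where
  "ordinary_aug w' \<phi> \<gamma> w \<longleftrightarrow>
     valuation w' \<and> \<phi> \<in> KP w' \<and> w' (to_rat \<phi>) < Fin \<gamma> \<and>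
     is_augmentation (\<lambda>f. w' (to_rat f)) \<phi> \<gamma> w"

text \<open>
  \<open>continuous_family w' m A \<chi> \<beta> \<rho>\<close>: \<open>(\<rho> i = [w'; \<chi> i, \<beta> i])\<close> for \<open>i \<in> A\<close> is a continuous family
  of augmentations of \<open>w'\<close> of degree \<open>m\<close>.
\<close>

definition continuous_family ::
  "('a::field, 'g::linordered_ab_group_add) ratval \<Rightarrow> nat \<Rightarrow> 'b::linorder set
    \<Rightarrow> ('b \<Rightarrow> 'a poly) \<Rightarrow> ('b \<Rightarrow> 'g) \<Rightarrow> ('b \<Rightarrow> ('a, 'g) ratval) \<Rightarrow> bool" where
  "continuous_family w' m A \<chi> \<beta> \<rho> \<longleftrightarrow>
     A \<noteq> {} \<and> (\<forall>i\<in>A. \<exists>j\<in>A. i < j) \<and>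
     (\<forall>i\<in>A. \<forall>j\<in>A. i < j \<longrightarrow> \<beta> i < \<beta> j) \<and>
     (\<forall>i\<in>A. ordinary_aug w' (\<chi> i) (\<beta> i) (\<rho> i) \<and> Polynomial.degree (\<chi> i) = m) \<and>
     (\<forall>i\<in>A. \<forall>j\<in>A. i < j \<longrightarrow>
        \<not> val_equiv (\<rho> i) (\<chi> j) (\<chi> i) \<and> ordinary_aug (\<rho> i) (\<chi> j) (\<beta> j) (\<rho> j))"

definition stable ::
  "'b::linorder set \<Rightarrow> ('b \<Rightarrow> ('a::field, 'g::linordered_ab_group_add) ratval)
    \<Rightarrow> 'a poly \<Rightarrow> bool" where
  "stable A \<rho> f \<longleftrightarrow> (\<exists>i0\<in>A. \<forall>i\<in>A. i0 \<le> i \<longrightarrow> \<rho> i (to_rat f) = \<rho> i0 (to_rat f))"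

definition stable_value ::
  "'b::linorder set \<Rightarrow> ('b \<Rightarrow> ('a::field, 'g::linordered_ab_group_add) ratval)
    \<Rightarrow> 'a poly \<Rightarrow> 'g extended" where
  "stable_value A \<rho> f = (THE x. \<exists>i0\<in>A. \<forall>i\<in>A. i0 \<le> i \<longrightarrow> \<rho> i (to_rat f) = x)"

definition stable_limit ::
  "'b::linorder set \<Rightarrow> ('b \<Rightarrow> ('a::field, 'g::linordered_ab_group_add) ratval)
    \<Rightarrow> ('a, 'g) ratval \<Rightarrow> bool" where
  "stable_limit A \<rho> w \<longleftrightarrow> valuation w \<and>
     (\<forall>f. stable A \<rho> f \<and> w (to_rat f) = stable_value A \<rho> f)"

text \<open>The infimum of the empty set in \<open>enat\<close> is infinity.\<close>

definition m_inf ::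
  "'b::linorder set \<Rightarrow> ('b \<Rightarrow> ('a::field, 'g::linordered_ab_group_add) ratval) \<Rightarrow> enat" where
  "m_inf A \<rho> = (INF f\<in>{f. \<not> stable A \<rho> f}. enat (Polynomial.degree f))"

definition KP_inf ::
  "'b::linorder set \<Rightarrow> ('b \<Rightarrow> ('a::field, 'g::linordered_ab_group_add) ratval) \<Rightarrow> 'a poly set" where
  "KP_inf A \<rho> = {f. lead_coeff f = 1 \<and> \<not> stable A \<rho> f \<and> enat (Polynomial.degree f) = m_inf A \<rho>}"

text \<open>
  In the two definitions below a continuous family is indexed by a subset of the group 'g. This is
  no restriction: \<open>\<beta>\<close> is strictly increasing on the index set, so every index set is
  order-isomorphic to a subset of 'g.
\<close>

definition limit_aug ::
  "('a::field, 'g::linordered_ab_group_add) ratval \<Rightarrow> 'a poly \<Rightarrow> 'g \<Rightarrow> ('a, 'g) ratval \<Rightarrow> bool" where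
  "limit_aug w' \<phi> \<gamma> w \<longleftrightarrow>
     (\<exists>m (A :: 'g set) \<chi> \<beta> \<rho>.
        continuous_family w' m A \<chi> \<beta> \<rho> \<and> enat m < m_inf A \<rho> \<and> m_inf A \<rho> < \<infinity> \<and>
        \<phi> \<in> KP_inf A \<rho> \<and> (\<forall>i\<in>A. \<rho> i (to_rat \<phi>) < Fin \<gamma>) \<and>
        is_augmentation (stable_value A \<rho>) \<phi> \<gamma> w)"

definition limit_of_continuous_family ::
  "('a::field, 'g::linordered_ab_group_add) ratval \<Rightarrow> ('a, 'g) ratval \<Rightarrow> bool" where
  "limit_of_continuous_family w' w \<longleftrightarrow>
     (\<exists>m (A :: 'g set) \<chi> \<beta> \<rho>. continuous_family w' m A \<chi> \<beta> \<rho> \<and> stable_limit A \<rho> w)"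

section \<open>Chains\<close>

text \<open>
  The valuations \<open>ws n\<close> of a chain are indexed by \<open>n \<in> J\<close>, where \<open>J\<close> is \<open>{..r}\<close> or \<open>UNIV\<close>.
\<close>

definition augmentation_chain ::
  "nat set \<Rightarrow> (nat \<Rightarrow> 'a::field poly) \<Rightarrow> (nat \<Rightarrow> 'g)
    \<Rightarrow> (nat \<Rightarrow> ('a, 'g::linordered_ab_group_add) ratval) \<Rightarrow> bool" where
  "augmentation_chain J \<phi> \<gamma> ws \<longleftrightarrow>
     (\<forall>n. Suc n \<in> J \<longrightarrow>
        ordinary_aug (ws n) (\<phi> (Suc n)) (\<gamma> (Suc n)) (ws (Suc n)) \<or>
        limit_aug (ws n) (\<phi> (Suc n)) (\<gamma> (Suc n)) (ws (Suc n)))"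

definition MLV_chain ::
  "nat set \<Rightarrow> (nat \<Rightarrow> 'a::field poly) \<Rightarrow> (nat \<Rightarrow> 'g)
    \<Rightarrow> (nat \<Rightarrow> ('a, 'g::linordered_ab_group_add) ratval) \<Rightarrow> bool" where
  "MLV_chain J \<phi> \<gamma> ws \<longleftrightarrow>
     augmentation_chain J \<phi> \<gamma> ws \<and>
     \<phi> 0 \<in> KP (ws 0) \<and> Polynomial.degree (\<phi> 0) = deg_val (ws 0) \<and>
     ws 0 (to_rat (\<phi> 0)) = Fin (\<gamma> 0) \<and>
     (\<forall>n. Suc n \<in> J \<longrightarrow>
        val_less (ws n) (ws (Suc n)) \<and>
        (ordinary_aug (ws n) (\<phi> (Suc n)) (\<gamma> (Suc n)) (ws (Suc n)) \<longrightarrow>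
           deg_val (ws n) < deg_Phi (ws n) (ws (Suc n))) \<and>
        (limit_aug (ws n) (\<phi> (Suc n)) (\<gamma> (Suc n)) (ws (Suc n)) \<longrightarrow>
           deg_val (ws n) = deg_Phi (ws n) (ws (Suc n)) \<and> \<phi> n \<notin> Phi (ws n) (ws (Suc n))))"

definition depth_zero ::
  "('a::field \<Rightarrow> 'g extended) \<Rightarrow> ('a, 'g::linordered_ab_group_add) ratval \<Rightarrow> bool" where
  "depth_zero v w0 \<longleftrightarrow> valuation w0 \<and>
     (\<exists>\<alpha> \<epsilon>. \<forall>n a. w0 (to_rat (\<Sum>i\<le>n. smult (a i) ([:- \<alpha>, 1:] ^ i))) =
        Min ((\<lambda>i. v (a i) + Fin (nmult i \<epsilon>)) ` {..n}))"

definition complete_MLV_chain ::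
  "('a::field \<Rightarrow> 'g extended) \<Rightarrow> nat set \<Rightarrow> (nat \<Rightarrow> 'a poly) \<Rightarrow> (nat \<Rightarrow> 'g)
    \<Rightarrow> (nat \<Rightarrow> ('a, 'g::linordered_ab_group_add) ratval) \<Rightarrow> bool" where
  "complete_MLV_chain v J \<phi> \<gamma> ws \<longleftrightarrow> MLV_chain J \<phi> \<gamma> ws \<and> depth_zero v (ws 0)"

text \<open>
  The two alternatives. In the first one the chain up to \<open>w\<^sub>r\<close> is only required to consist
  of augmentation steps.
\<close>

definition stable_limit_after_finite_chain ::
  "('a::field, 'g::linordered_ab_group_add) ratval \<Rightarrow> nat \<Rightarrow> (nat \<Rightarrow> 'a poly) \<Rightarrow> (nat \<Rightarrow> 'g)
    \<Rightarrow> (nat \<Rightarrow> ('a, 'g) ratval) \<Rightarrow> bool" where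
  "stable_limit_after_finite_chain w r \<phi> \<gamma> ws \<longleftrightarrow>
     augmentation_chain {..r} \<phi> \<gamma> ws \<and>
     limit_of_continuous_family (ws r) w \<and>
     val_less (ws r) w \<and> deg_Phi (ws r) w = deg_val (ws r) \<and> \<phi> r \<notin> Phi (ws r) w"

definition stable_limit_of_infinite_chain ::
  "('a::field \<Rightarrow> 'g extended) \<Rightarrow> ('a, 'g::linordered_ab_group_add) ratval
    \<Rightarrow> (nat \<Rightarrow> 'a poly) \<Rightarrow> (nat \<Rightarrow> 'g) \<Rightarrow> (nat \<Rightarrow> ('a, 'g) ratval) \<Rightarrow> bool" where
  "stable_limit_of_infinite_chain v w \<phi> \<gamma> ws \<longleftrightarrow>
     complete_MLV_chain v UNIV \<phi> \<gamma> ws \<and> stable_limit UNIV ws w"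

end

theory Submission
  imports Defs
begin

text \<open>
  The proof rests on one inequality. Say that reduction modulo \<open>Q\<close> is strict for \<open>w\<close> if, for
  nonzero \<open>f\<close> and \<open>g\<close> of degree less than \<open>deg Q\<close>, the product \<open>f g\<close> and its remainder modulo \<open>Q\<close>
  differ by something of value greater than \<open>w (f g)\<close>. Reduction modulo an abstract key polynomial
  is strict (\<open>strict_reduction_of_abkp\<close>): take a root \<open>\<alpha>\<close> of \<open>Q\<close> for which \<open>X - \<alpha>\<close> has the largest
  value. All roots of a polynomial \<open>F\<close> of smaller degree are farther from \<open>X\<close> than \<open>\<alpha>\<close> is, so \<open>F\<close>
  agrees with the constant \<open>F(\<alpha>)\<close> up to terms of greater value. Now \<open>f g\<close> and its remainder take the
  same value at \<open>\<alpha>\<close>, hence they agree up to terms of greater value as well. From this point on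
  everything happens in \<open>K[X]\<close>.

  Strictness has two consequences. The truncation at \<open>Q\<close> is a valuation
  (\<open>ring_valuation_trunc\<close>), and \<open>Q\<close> is a key polynomial of minimal degree for it
  (\<open>key_truncation_key_polynomial\<close>). Moreover, an expansion in powers of a polynomial of degree less
  than \<open>deg Q\<close> always underestimates the value of \<open>Q\<close> (\<open>aug_less_of_strict_reduction\<close>).

  Let \<open>w\<^sub>i\<close> be the truncation at the \<open>i\<close>-th member of the sequence. As the values \<open>w (Q\<^sub>i)\<close>
  increase, the valuations \<open>w\<^sub>i\<close> increase too and stay below \<open>w\<close>, and \<open>w\<^sub>i (Q\<^sub>j) < w (Q\<^sub>j)\<close> for
  \<open>i < j\<close>. Completeness says that every polynomial gets its value under \<open>w\<close> from some \<open>w\<^sub>i\<close>, hence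
  from all later ones. A monic polynomial of minimal degree among those whose value increases from one
  valuation to a larger one is a key polynomial for the smaller one, and it divides, in the sense of
  that valuation, exactly the polynomials whose value increases (\<open>Phi_key_polynomial\<close>). Therefore:

  \<^item> If \<open>\<theta> j\<close> is empty, the truncations at \<open>Q\<^sub>j\<close> and \<open>w\<close> agree below the degree of \<open>Q\<^sub>j\<^sub>+\<^sub>1\<close>, and
    the next truncation is an ordinary augmentation.

  \<^item> If \<open>\<theta> j\<close> is not empty, the truncations at its members form a continuous family. All polynomials
    of degree less than that of \<open>Q\<^sub>j\<^sub>+\<^sub>1\<close> are stable, with their value under \<open>w\<close>. The polynomial
    \<open>Q\<^sub>j\<^sub>+\<^sub>1\<close> itself is not: each of its values along the family is less than its value under \<open>w\<close>, so
    it is divisible by the next member of the family and its value increases once more. Hence the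
    next truncation is a limit augmentation.

  Since there is no last index, either there is a last block, which then contains a continuous family
  with stable limit \<open>w\<close>, or the chain is infinite and has the stable limit \<open>w\<close> itself. These cases
  exclude each other: if \<open>w\<close> is the stable limit of a continuous family of degree \<open>m\<close>, every polynomial
  gets its value from an expansion in powers of a polynomial of degree \<open>m\<close>, so the
  underestimate above bounds the degree of every abstract key polynomial by \<open>m\<close>, whereas the
  degrees in an infinite chain are unbounded. Likewise no step is ordinary and limit at once, because
  an ordinary step preserves all values below the degree of its key polynomial and a limit
  step does not (\<open>ordinary_aug_not_limit_aug\<close>).
\<close>

section \<open>Valuations on rings and on fraction fields\<close>

lemma extended_add_less_le:
  fixes a b c d :: "'g::linordered_ab_group_add extended"
  assumes "a < b" and "c \<le> d" and "c \<noteq> Pinf" and "c \<noteq> Minf"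
  shows "a + c < b + d"
  using assms by (cases a; cases b; cases c; cases d) (auto intro: add_less_le_mono)

lemma extended_add_le_less:
  fixes a b c d :: "'g::linordered_ab_group_add extended"
  assumes "c \<le> d" and "a < b" and "c \<noteq> Pinf" and "c \<noteq> Minf"
  shows "c + a < d + b"
  using extended_add_less_le[of a b c d] assms by (simp add: add.commute)

lemma extended_add_eq_Pinf_iff:
  "(a::'g::linordered_ab_group_add extended) + b = Pinf \<longleftrightarrow> a = Pinf \<or> b = Pinf"
  by (cases a; cases b) auto

lemma extended_Pinf_add [simp]:
  "Pinf + (a::'g::linordered_ab_group_add extended) = Pinf" "a + Pinf = Pinf"
  by (cases a; simp)+

lemma extended_min_add_distrib:
  fixes a b c :: "'g::linordered_ab_group_add extended"
  shows "min a b + c = min (a + c) (b + c)"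
  by (cases "a \<le> b") (auto simp: min_def add_right_mono intro: antisym add_right_mono)

lemma nmult_Suc: "nmult (Suc i) \<gamma> = \<gamma> + nmult i \<gamma>"
  by (simp add: nmult_def add.commute)

lemma nmult_0 [simp]: "nmult 0 \<gamma> = 0"
  by (simp add: nmult_def)

text \<open>
  A valuation restricted to polynomials is still a function with the four properties of a valuation, but
  on an integral domain; all computations below take place there.
\<close>

locale ring_valuation =
  fixes u :: "'r::idom \<Rightarrow> 'g::linordered_ab_group_add extended"
  assumes eq_Pinf_iff: "u x = Pinf \<longleftrightarrow> x = 0"
    and not_Minf [simp]: "u x \<noteq> Minf"
    and mult: "u (x * y) = u x + u y"
    and add_ge: "min (u x) (u y) \<le> u (x + y)"
begin

lemma zero [simp]: "u 0 = Pinf"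
  by (simp add: eq_Pinf_iff)

lemma finite_value: "x \<noteq> 0 \<Longrightarrow> \<exists>a. u x = Fin a"
  using eq_Pinf_iff[of x] not_Minf[of x] by (cases "u x") auto

lemma one [simp]: "u 1 = 0"
proof -
  obtain a where a: "u 1 = Fin a" using finite_value[of 1] by auto
  have "u 1 + u 1 = u 1" using mult[of 1 1] by simp
  then show ?thesis using a by (simp add: zero_extended_def)
qed

lemma minus [simp]: "u (- x) = u x"
proof -
  obtain a where a: "u (-1) = Fin a" using finite_value[of "-1"] by auto
  have "u (-1) + u (-1) = 0" using mult[of "-1" "-1"] by simp
  then have "u (-1) = 0" using a by (simp add: zero_extended_def)
  then show ?thesis using mult[of "-1" x] by simp
qed

lemma diff_ge: "min (u x) (u y) \<le> u (x - y)"
  using add_ge[of x "- y"] by simp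

lemma less_add: "c < u x \<Longrightarrow> c < u y \<Longrightarrow> c < u (x + y)"
  and less_diff: "c < u x \<Longrightarrow> c < u y \<Longrightarrow> c < u (x - y)"
  using add_ge[of x y] diff_ge[of x y] by (auto simp: min_def split: if_splits)

lemma diff_commute: "u (x - y) = u (y - x)"
  by (metis minus minus_diff_eq)

lemma add_eq: 
  assumes "u x < u y"
  shows "u (x + y) = u x"
  using add_ge[of x y] diff_ge[of "x + y" y] assms
  by (auto simp: min_def split: if_splits)

lemma eq_of_diff_less:
  assumes "u x < u (x - y)"
  shows "u y = u x"
  using add_eq[of x "y - x"] assms diff_commute[of x y] by simp

lemma power_eq: "u x = Fin \<gamma> \<Longrightarrow> u (x ^ n) = Fin (nmult n \<gamma>)"
  by (induction n) (auto simp: mult nmult_Suc zero_extended_def)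

end

lemma valuation_iff: "valuation v \<longleftrightarrow> ring_valuation v"
  unfolding valuation_def ring_valuation_def by blast

lemma to_rat_add: "to_rat (f + g) = to_rat f + to_rat g"
  and to_rat_mult: "to_rat (f * g) = to_rat f * to_rat g"
  and to_rat_eq_0_iff: "to_rat f = 0 \<longleftrightarrow> f = 0"
  by (auto simp: to_rat_def Zero_fract_def eq_fract)

lemma ring_valuation_to_rat:
  assumes "valuation w"
  shows "ring_valuation (\<lambda>f. w (to_rat f))"
proof -
  interpret ring_valuation w using assms by (simp add: valuation_iff)
  show ?thesis
    by unfold_locales (auto simp: eq_Pinf_iff to_rat_eq_0_iff to_rat_mult mult to_rat_add add_ge)
qed

text \<open>
  The quotient rule is independent of the chosen fraction, so the choice operator picks the only
  candidate; see \<open>fract_valuation_Fract\<close>.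
\<close>

definition fract_valuation :: 
  "('a::field poly \<Rightarrow> 'g::linordered_ab_group_add extended) \<Rightarrow> ('a, 'g) ratval" where
  "fract_valuation u x = 
     (SOME y. \<exists>p q. q \<noteq> 0 \<and> x = Fraction_Field.Fract p q \<and> y = u p - u q)"

lemma extended_diff_eq_iff:
  fixes a b c d :: "'g::linordered_ab_group_add extended"
  assumes "b \<noteq> Pinf" and "b \<noteq> Minf" and "d \<noteq> Pinf" and "d \<noteq> Minf" 
  shows "a - b = c - d \<longleftrightarrow> a + d = c + b"
  using assms by (cases a; cases b; cases c; cases d) (auto simp: algebra_simps)

lemma fract_valuation_Fract:
  assumes "ring_valuation u" and "q \<noteq> 0"
  shows "fract_valuation u (Fraction_Field.Fract p q) = u p - u q"
proof -
  interpret ring_valuation u by fact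
  have *: "u p' - u q' = u p - u q"
    if "q' \<noteq> 0" and "Fraction_Field.Fract p q = Fraction_Field.Fract p' q'" for p' q'
  proof -
    have "p' * q = p * q'"
      using that assms(2) by (simp add: eq_fract)
    then have "u p' + u q = u p + u q'" by (metis mult)
    then show ?thesis
      using finite_value[OF assms(2)] finite_value[OF that(1)]
      by (subst extended_diff_eq_iff) auto
  qed
  show ?thesis unfolding fract_valuation_def
    by (rule some_equality) (use assms(2) * in blast)+
qed

lemma fract_valuation_to_rat:
  assumes "ring_valuation u"
  shows "fract_valuation u (to_rat f) = u f"
proof -
  interpret ring_valuation u by fact
  have "u f - 0 = u f"
    using not_Minf[of f] by (cases "u f") (auto simp: zero_extended_def simp del: not_Minf)
  then show ?thesis by (simp add: to_rat_def fract_valuation_Fract[OF assms])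
qed

lemma valuation_fract_valuation:
  assumes "ring_valuation u"
  shows "valuation (fract_valuation u)"
proof -
  interpret ring_valuation u by fact
  note F = fract_valuation_Fract[OF assms]
  show ?thesis unfolding valuation_def
  proof (intro conjI allI)
    fix x :: "'a poly fract"
    show "fract_valuation u x = Pinf \<longleftrightarrow> x = 0"
    proof (cases x rule: Fract_cases)
      case (Fract p q)
      then show ?thesis
        using finite_value[of q] eq_Pinf_iff[of p]
        by (cases "u p") (auto simp: F Zero_fract_def eq_fract)
    qed
    show "fract_valuation u x \<noteq> Minf"
    proof (cases x rule: Fract_cases)
      case (Fract p q)
      then show ?thesis using finite_value[of q] not_Minf[of p]
        by (cases "u p") (auto simp: F simp del: not_Minf)
    qed
  next
    fix x y :: "'a poly fract"
    obtain p q :: "'a poly" where x: "x = Fraction_Field.Fract p q" "q \<noteq> 0" by (cases x rule: Fract_cases)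
    obtain r s :: "'a poly" where y: "y = Fraction_Field.Fract r s" "s \<noteq> 0" by (cases y rule: Fract_cases)
    obtain a b where ab: "u q = Fin a" "u s = Fin b" using finite_value x y by metis
    show "fract_valuation u (x * y) = fract_valuation u x + fract_valuation u y"
      using x y ab not_Minf[of p] not_Minf[of r]
      by (cases "u p"; cases "u r") (auto simp: F mult algebra_simps simp del: not_Minf)
    have "min (u (p * s)) (u (r * q)) \<le> u (p * s + r * q)" by (rule add_ge)
    then show "min (fract_valuation u x) (fract_valuation u y) \<le> fract_valuation u (x + y)"
      using x y ab not_Minf[of p] not_Minf[of r]
      by (cases "u p"; cases "u r"; cases "u (p * s + r * q)")
         (auto simp: F mult algebra_simps min_def simp del: not_Minf split: if_splits)
  qed
qed

section \<open>Expansions in powers of a polynomial\<close>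

text \<open>
  The formula that defines both kinds of augmentation, as a function on polynomials. With the values of
  \<open>w\<close> for \<open>u\<close> and \<open>w Q = Fin \<gamma>\<close> it is also the truncation of \<open>w\<close> at \<open>Q\<close>.
\<close>

definition aug :: "('a::field poly \<Rightarrow> 'g::linordered_ab_group_add extended) \<Rightarrow> 'a poly \<Rightarrow> 'g \<Rightarrow> 'a poly \<Rightarrow> 'g extended" where
  "aug u Q \<gamma> f =
     Min ((\<lambda>i. u (exp_coeff Q f i) + Fin (nmult i \<gamma>)) ` {..degree f})"

lemma exp_coeff_0: "exp_coeff Q f 0 = f mod Q"
  by (simp add: exp_coeff_def)

lemma exp_coeff_Suc: "exp_coeff Q f (Suc i) = exp_coeff Q (f div Q) i"
  by (simp add: exp_coeff_def poly_div_mult_right)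

text \<open>
  Lower bounds turn the minimum over a range that depends on \<open>f\<close> into a condition on all digits, so
  that polynomials of different degrees can be compared.
\<close>

lemma le_aug_iff:
  assumes "u 0 = Pinf" and "degree Q > 0"
  shows "x \<le> aug u Q \<gamma> f \<longleftrightarrow> (\<forall>i. x \<le> u (exp_coeff Q f i) + Fin (nmult i \<gamma>))"
proof -
  have "x \<le> u (exp_coeff Q f i) + Fin (nmult i \<gamma>)" if "i > degree f" for i
    using exp_coeff_eq_0[OF assms(2) that] assms(1) by simp
  moreover have "x \<le> aug u Q \<gamma> f \<longleftrightarrow>
      (\<forall>i\<le>degree f. x \<le> u (exp_coeff Q f i) + Fin (nmult i \<gamma>))"
    unfolding aug_def by (subst Min_ge_iff) (auto simp: Ball_def)
  ultimately show ?thesis by (meson not_le)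
qed

lemma aug_attained:
  obtains i where "aug u Q \<gamma> f = u (exp_coeff Q f i) + Fin (nmult i \<gamma>)"
proof -
  have "aug u Q \<gamma> f \<in> (\<lambda>i. u (exp_coeff Q f i) + Fin (nmult i \<gamma>)) ` {..degree f}"
    unfolding aug_def by (rule Min_in) auto
  then show ?thesis using that by blast
qed

text \<open>
  Dividing by \<open>Q\<close> removes the digit of index 0 and shifts the others; this is the induction along the
  expansion.
\<close>

lemma div_degree_induct [consumes 1, case_names less step]:
  fixes Q f :: "'a::field poly"
  assumes "degree Q > 0"
    and less: "\<And>f. degree f < degree Q \<Longrightarrow> P f"
    and step: "\<And>f. f div Q \<noteq> 0 \<Longrightarrow> P (f div Q) \<Longrightarrow> P f"
  shows "P f"
proof (induction "degree f" arbitrary: f rule: less_induct)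
  case 1: less
  show ?case
  proof (cases "degree f < degree Q")
    case False
    then have "f div Q \<noteq> 0" using assms(1) div_poly_eq_0_iff[of f Q] by auto
    moreover have "degree (f div Q) < degree f"
      using degree_div_less[of f Q] False assms(1) by auto
    ultimately show ?thesis using 1 step by blast
  qed (rule less)
qed

lemma extended_le_Fin_add_iff:
  fixes x y :: "'g::linordered_ab_group_add extended"
  shows "x \<le> Fin \<gamma> + y \<longleftrightarrow> Fin (- \<gamma>) + x \<le> y"
  by (cases x; cases y) (auto simp: algebra_simps)

lemma aug_zero [simp]:
  assumes "u 0 = Pinf"
  shows "aug u Q \<gamma> 0 = Pinf"
  using assms by (simp add: aug_def exp_coeff_def)

lemma aug_step:
  assumes "u 0 = Pinf" and "degree Q > 0"
  shows "aug u Q \<gamma> f = min (u (f mod Q)) (Fin \<gamma> + aug u Q \<gamma> (f div Q))" (is "?a = ?b")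
proof -
  have *: "x \<le> ?a \<longleftrightarrow> x \<le> ?b" for x
  proof -
    have "x \<le> ?a \<longleftrightarrow> x \<le> u (exp_coeff Q f 0) + Fin (nmult 0 \<gamma>) \<and>
        (\<forall>i. x \<le> u (exp_coeff Q f (Suc i)) + Fin (nmult (Suc i) \<gamma>))"
      unfolding le_aug_iff[of u Q, OF assms] by (metis not0_implies_Suc)
    also have "x \<le> u (exp_coeff Q f 0) + Fin (nmult 0 \<gamma>) \<longleftrightarrow> x \<le> u (f mod Q)"
      by (simp add: exp_coeff_0 flip: zero_extended_def)
    also have "(\<forall>i. x \<le> u (exp_coeff Q f (Suc i)) + Fin (nmult (Suc i) \<gamma>)) \<longleftrightarrow>
        (\<forall>i. x \<le> Fin \<gamma> + (u (exp_coeff Q (f div Q) i) + Fin (nmult i \<gamma>)))"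
      by (simp add: exp_coeff_Suc nmult_Suc add.left_commute flip: plus_extended.simps(1))
    also have "\<dots> \<longleftrightarrow> x \<le> Fin \<gamma> + aug u Q \<gamma> (f div Q)"
      unfolding extended_le_Fin_add_iff le_aug_iff[of u Q, OF assms] ..
    finally show ?thesis by simp
  qed
  show ?thesis by (rule antisym) (use * in blast)+
qed

lemma aug_low:
  assumes "u 0 = Pinf" and "degree f < degree Q"
  shows "aug u Q \<gamma> f = u f"
  using aug_step[of u Q \<gamma> f] assms by (simp add: mod_poly_less div_poly_less)

lemma aug_mult_key:
  assumes "u 0 = Pinf" and "degree Q > 0"
  shows "aug u Q \<gamma> (Q * f) = Fin \<gamma> + aug u Q \<gamma> f"
proof -
  have "Q \<noteq> 0" using assms(2) by auto
  then show ?thesis using aug_step[of u Q, OF assms, of \<gamma> "Q * f"] assms(1) by simp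
qed

lemma aug_cong:
  assumes "\<And>f. degree f < degree Q \<Longrightarrow> u f = u' f" and "degree Q > 0"
  shows "aug u Q \<gamma> f = aug u' Q \<gamma> f"
  unfolding aug_def using assms by (simp add: degree_exp_coeff)

text \<open>
  A valuation is at least the minimum over the terms of the expansion, so it dominates the augmentation
  as soon as it dominates it on the digits and on \<open>Q\<close>.
\<close>

lemma aug_le_valuation:
  assumes "ring_valuation u'" and "u 0 = Pinf" and "degree Q > 0"
    and low: "\<And>f. degree f < degree Q \<Longrightarrow> u f \<le> u' f" and key: "Fin \<gamma> \<le> u' Q"
  shows "aug u Q \<gamma> f \<le> u' f"
  using \<open>degree Q > 0\<close>
proof (induction f rule: div_degree_induct)
  case (less f)
  then show ?case using aug_low[of u, OF assms(2)] low by metis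
next
  case (step f)
  interpret ring_valuation u' by fact
  have "degree (f mod Q) < degree Q"
    using degree_exp_coeff[of Q f 0] assms(3) by (simp add: exp_coeff_0)
  then have "aug u Q \<gamma> f \<le> min (u' (f mod Q)) (u' Q + u' (f div Q))"
    using low step(2) key
    by (subst aug_step[of u Q, OF assms(2,3)]) (intro min.mono add_mono, auto)
  also have "\<dots> \<le> u' (f mod Q + Q * (f div Q))" unfolding mult[symmetric] by (rule add_ge)
  finally show ?case by simp
qed

text \<open>
  If passing to the remainder never decreases the value, then no term of the expansion of \<open>f\<close> has
  value less than \<open>u f\<close>.
\<close>

lemma valuation_le_aug:
  assumes "ring_valuation u" and "degree Q > 0"
    and mod: "\<And>f. u f \<le> u (f mod Q)" and key: "u Q \<le> Fin \<gamma>"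
  shows "u f \<le> aug u Q \<gamma> f"
  using \<open>degree Q > 0\<close>
proof (induction f rule: div_degree_induct)
  case (less f)
  interpret ring_valuation u by fact
  show ?case using aug_low[of u f Q \<gamma>] less by simp
next
  case (step f)
  interpret ring_valuation u by fact
  have "u f \<le> min (u f) (u (f mod Q))" using mod by simp
  also have "\<dots> \<le> u (f - f mod Q)" by (rule diff_ge)
  also have "f - f mod Q = Q * (f div Q)" by (simp add: minus_mod_eq_mult_div)
  also have "u \<dots> \<le> Fin \<gamma> + aug u Q \<gamma> (f div Q)"
    unfolding mult using key step by (intro add_mono)
  finally show ?case using mod by (subst aug_step) (auto simp: assms(2))
qed

text \<open>
  This is what remains of the notion of an abstract key polynomial once the algebraic closure is
  eliminated.
\<close>

definition strict_reduction ::
  "('a::field poly \<Rightarrow> 'g::linordered_ab_group_add extended) \<Rightarrow> 'a poly \<Rightarrow> bool" where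
  "strict_reduction u Q \<longleftrightarrow> lead_coeff Q = 1 \<and> degree Q > 0 \<and>
     (\<forall>f g. f \<noteq> 0 \<longrightarrow> g \<noteq> 0 \<longrightarrow> degree f < degree Q \<longrightarrow> degree g < degree Q \<longrightarrow>
        u (f * g) < u (f * g - f * g mod Q))"

text \<open>
  The case that matters is \<open>f = Q\<close>: expanding \<open>Q\<close> in powers of a polynomial \<open>\<phi>\<close> of smaller degree
  underestimates its value. The reason is that reduction modulo \<open>Q\<close> changes each term of the expansion
  by something of greater value, and the reduced terms of \<open>Q\<close> add up to 0. Stating this for all \<open>f\<close>
  makes it accessible to induction along the expansion in powers of \<open>\<phi>\<close>.
\<close>

lemma aug_less_of_strict_reduction:
  assumes "ring_valuation u" and Q: "strict_reduction u Q"
    and \<phi>: "0 < degree \<phi>" "degree \<phi> < degree Q" and \<gamma>: "Fin \<gamma> \<le> u \<phi>" and "f \<noteq> 0"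
  shows "aug u \<phi> \<gamma> f < u (f - f mod Q)"
  using \<phi>(1) \<open>f \<noteq> 0\<close>
proof (induction f rule: div_degree_induct)
  case (less f)
  interpret ring_valuation u by fact
  have "aug u \<phi> \<gamma> f = u f" using less(1) by (simp add: aug_low)
  moreover have "f - f mod Q = 0" using less(1) \<phi>(2) by (simp add: mod_poly_less)
  ultimately show ?case using finite_value[OF less(2)] by auto
next
  case (step f)
  interpret ring_valuation u by fact
  define h where "h = f div \<phi>"
  define r where "r = h mod Q"
  have IH: "aug u \<phi> \<gamma> h < u (h - r)" using step by (simp add: h_def r_def)
  have le: "aug u \<phi> \<gamma> f \<le> Fin \<gamma> + aug u \<phi> \<gamma> h"
    unfolding h_def by (subst aug_step) (auto simp: \<phi>)
  have deg0: "degree (f mod \<phi>) < degree Q"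
    using degree_exp_coeff[of \<phi> f 0] \<phi> by (simp add: exp_coeff_0)
  have "f mod Q = (f mod \<phi> + \<phi> * h) mod Q" by (simp add: h_def)
  also have "\<dots> = f mod \<phi> + \<phi> * r mod Q"
    using deg0 by (simp add: poly_mod_add_left mod_poly_less r_def mod_mult_right_eq)
  finally have "f - f mod Q = (f mod \<phi> + \<phi> * h) - (f mod \<phi> + \<phi> * r mod Q)"
    by (simp add: h_def)
  also have "\<dots> = \<phi> * (h - r) + (\<phi> * r - \<phi> * r mod Q)" by (simp add: algebra_simps)
  finally have eq: "f - f mod Q = \<phi> * (h - r) + (\<phi> * r - \<phi> * r mod Q)" .
  have 1: "Fin \<gamma> + aug u \<phi> \<gamma> h < u (\<phi> * (h - r))"
    unfolding mult using \<gamma> IH by (intro extended_add_le_less) auto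
  have 2: "Fin \<gamma> + aug u \<phi> \<gamma> h < u (\<phi> * r - \<phi> * r mod Q)"
  proof (cases "r = 0")
    case True
    moreover have "aug u \<phi> \<gamma> h \<noteq> Pinf" using IH by auto
    ultimately show ?thesis by (cases "aug u \<phi> \<gamma> h") auto
  next
    case False
    have "aug u \<phi> \<gamma> h \<le> u h"
      using \<gamma> \<phi> by (intro aug_le_valuation ring_valuation_axioms) auto
    then have "aug u \<phi> \<gamma> h \<le> u (h - (h - r))"
      using diff_ge[of h "h - r"] IH by (auto simp: min_def split: if_splits)
    then have "Fin \<gamma> + aug u \<phi> \<gamma> h \<le> u (\<phi> * r)"
      unfolding mult using \<gamma> by (intro add_mono) auto
    also have "\<dots> < u (\<phi> * r - \<phi> * r mod Q)"
    proof -
      have "degree r < degree Q"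
        using degree_exp_coeff[of Q h 0] \<phi> by (simp add: exp_coeff_0 r_def)
      moreover have "\<phi> \<noteq> 0" using \<phi> by auto
      ultimately show ?thesis using Q \<phi> False by (simp add: strict_reduction_def)
    qed
    finally show ?thesis .
  qed
  have "Fin \<gamma> + aug u \<phi> \<gamma> h < min (u (\<phi> * (h - r))) (u (\<phi> * r - \<phi> * r mod Q))"
    using 1 2 by simp
  also have "\<dots> \<le> u (f - f mod Q)" unfolding eq by (rule add_ge)
  finally show ?case using le by simp
qed

section \<open>Truncations are valuations\<close>

locale key_truncation = ring_valuation u
  for u :: "'a::field poly \<Rightarrow> 'g::linordered_ab_group_add extended" +
  fixes Q :: "'a poly" and \<gamma> :: 'g
  assumes strict: "strict_reduction u Q" and value_Q: "u Q = Fin \<gamma>"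
begin

abbreviation trunc :: "'a poly \<Rightarrow> 'g extended" where
  "trunc \<equiv> aug u Q \<gamma>"

lemma degree_Q [simp]: "degree Q > 0" and Q_nonzero [simp]: "Q \<noteq> 0" and monic_Q: "lead_coeff Q = 1"
  using strict by (auto simp: strict_reduction_def)

lemma degree_mod_Q [simp]: "degree (f mod Q) < degree Q"
  using degree_exp_coeff[of Q f 0] by (simp add: exp_coeff_0)

lemma trunc_step: "trunc f = min (u (f mod Q)) (Fin \<gamma> + trunc (f div Q))"
  by (rule aug_step) auto

lemma trunc_low: "degree f < degree Q \<Longrightarrow> trunc f = u f"
  by (rule aug_low) auto

lemma trunc_mult_Q: "trunc (Q * f) = Fin \<gamma> + trunc f"
  by (rule aug_mult_key) auto

lemma trunc_Q: "trunc Q = Fin \<gamma>"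
  using trunc_mult_Q[of 1] trunc_low[of 1] by (simp flip: zero_extended_def)

lemma trunc_le: "trunc f \<le> u f"
  by (rule aug_le_valuation) (auto simp: value_Q ring_valuation_axioms)

lemma value_mod_mult:
  assumes "degree f < degree Q" and "degree g < degree Q"
  shows "u (f * g mod Q) = u (f * g)"
  using assms strict eq_of_diff_less[of "f * g" "f * g mod Q"]
  by (cases "f = 0 \<or> g = 0") (auto simp: strict_reduction_def)

lemma trunc_Pinf_iff: "trunc f = Pinf \<longleftrightarrow> f = 0"
proof
  assume "trunc f = Pinf"
  then have "Pinf \<le> u (exp_coeff Q f i) + Fin (nmult i \<gamma>)" for i
    using le_aug_iff[of u Q Pinf \<gamma> f] by simp
  then have "exp_coeff Q f i = 0" for i
    using eq_Pinf_iff by (simp add: extended_add_eq_Pinf_iff)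
  then show "f = 0" using expansion[of Q f] by simp
qed simp

lemma trunc_not_Minf [simp]: "trunc f \<noteq> Minf"
proof -
  obtain i where "trunc f = u (exp_coeff Q f i) + Fin (nmult i \<gamma>)" by (rule aug_attained)
  then show ?thesis using not_Minf[of "exp_coeff Q f i"] 
    by (cases "u (exp_coeff Q f i)") (auto simp del: not_Minf)
qed

lemma trunc_minus [simp]: "trunc (- f) = trunc f"
  unfolding aug_def by (simp add: exp_coeff_def poly_div_minus_left poly_mod_minus_left)

lemma trunc_add: "min (trunc f) (trunc g) \<le> trunc (f + g)"
proof (subst le_aug_iff; (intro allI)?)
  fix i
  have "min (trunc f) (trunc g) \<le> 
      min (u (exp_coeff Q f i) + Fin (nmult i \<gamma>)) (u (exp_coeff Q g i) + Fin (nmult i \<gamma>))"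
    using le_aug_iff[of u Q "trunc f" \<gamma> f] le_aug_iff[of u Q "trunc g" \<gamma> g]
    by (intro min.mono) auto
  also have "\<dots> = min (u (exp_coeff Q f i)) (u (exp_coeff Q g i)) + Fin (nmult i \<gamma>)"
    by (simp add: extended_min_add_distrib)
  also have "\<dots> \<le> u (exp_coeff Q f i + exp_coeff Q g i) + Fin (nmult i \<gamma>)"
    by (intro add_right_mono add_ge)
  also have "exp_coeff Q f i + exp_coeff Q g i = exp_coeff Q (f + g) i"
    by (simp add: exp_coeff_def poly_div_add_left poly_mod_add_left)
  finally show "min (trunc f) (trunc g) \<le> u (exp_coeff Q (f + g) i) + Fin (nmult i \<gamma>)" .
qed auto

lemma trunc_add_le:
  assumes "trunc f < trunc g"
  shows "trunc (f + g) \<le> trunc f"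
  using trunc_add[of "f + g" "- g"] assms by (auto simp: min_def split: if_splits)

text \<open>
  For two digits the product has the two digits \<open>f * g mod Q\<close> and \<open>f * g div Q\<close>, and
  strictness says that the second one contributes a greater value.
\<close>

lemma trunc_mult_low:
  assumes "degree f < degree Q" and "degree g < degree Q"
  shows "trunc (f * g) = u f + u g"
proof (cases "f = 0 \<or> g = 0")
  case True
  then show ?thesis by auto
next
  case False
  define h where "h = f * g div Q"
  have "degree h < degree Q"
  proof (cases "h = 0")
    case False
    have "degree h + degree Q = degree (h * Q)" using False by (simp add: degree_mult_eq)
    also have "h * Q = f * g - f * g mod Q" by (simp add: h_def minus_mod_eq_div_mult)
    also have "degree \<dots> \<le> max (degree (f * g)) (degree (f * g mod Q))"
      by (rule degree_diff_le_max)
    also have "\<dots> < degree Q + degree Q"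
      using assms degree_mult_le[of f g] degree_mod_Q[of "f * g"] by linarith
    finally show ?thesis by simp
  qed simp
  then have "Fin \<gamma> + trunc h = u (Q * h)" by (simp add: mult value_Q trunc_low)
  also have "Q * h = f * g - f * g mod Q" by (simp add: h_def minus_mod_eq_mult_div)
  also have "u \<dots> > u (f * g)" using False assms strict by (auto simp: strict_reduction_def)
  finally show ?thesis
    using trunc_step[of "f * g"] value_mod_mult[OF assms] by (simp add: h_def mult)
qed

text \<open>
  Write \<open>f = f0 + Q * f1\<close> and \<open>g = g0 + Q * g1\<close>. If \<open>f0\<close> does not attain the value of \<open>f\<close>, then
  \<open>Q * f1\<close> does and the product with \<open>f0\<close> is negligible, so the induction hypothesis for \<open>f1\<close>
  applies; the same works for \<open>g\<close>. If both \<open>f0\<close> and \<open>g0\<close> attain the value, then so does the digit of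
  index 0 of the product, which is \<open>f0 * g0 mod Q\<close>.
\<close>

lemma trunc_mult: "trunc (f * g) = trunc f + trunc g"
proof (induction "degree f + degree g" arbitrary: f g rule: less_induct)
  case less
  define f0 f1 g0 g1 where "f0 = f mod Q" and "f1 = f div Q" and "g0 = g mod Q" and "g1 = g div Q"
  have low: "degree f0 < degree Q" "degree g0 < degree Q" by (auto simp: f0_def g0_def)
  have f: "f = f0 + Q * f1" and g: "g = g0 + Q * g1" by (auto simp: f0_def f1_def g0_def g1_def)
  have degs: "degree (h mod Q) \<le> degree h" "h div Q \<noteq> 0 \<Longrightarrow> degree (h div Q) < degree h" for h
  proof -
    show "degree (h mod Q) \<le> degree h"
      using less_le_trans[OF degree_mod_Q[of h], of "degree h"] mod_poly_less[of h Q]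
      by (cases "degree h < degree Q") auto
    show "degree (h div Q) < degree h" if "h div Q \<noteq> 0"
      using that degree_div_less[of h Q] div_poly_less[of h Q] by (cases "degree h = 0") auto
  qed
  have IH1: "trunc (f1 * h) = trunc f1 + trunc h" if "degree h \<le> degree g" for h
  proof (cases "f1 = 0")
    case False
    then have "degree f1 + degree h < degree f + degree g"
      using degs(2)[of f] that by (simp add: f1_def)
    then show ?thesis by (rule less)
  qed simp
  have IH2: "trunc (h * g1) = trunc h + trunc g1" if "degree h \<le> degree f" for h
  proof (cases "g1 = 0")
    case False
    then have "degree h + degree g1 < degree f + degree g"
      using degs(2)[of g] that by (simp add: g1_def)
    then show ?thesis by (rule less)
  qed simp
  have le: "trunc f \<le> trunc f0" "trunc f \<le> Fin \<gamma> + trunc f1"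
      "trunc g \<le> trunc g0" "trunc g \<le> Fin \<gamma> + trunc g1"
    using trunc_step[of f] trunc_step[of g] low 
    by (auto simp: f0_def f1_def g0_def g1_def trunc_low)
  have low_mult: "trunc (f0 * g0) = trunc f0 + trunc g0"
    using trunc_mult_low low by (simp add: trunc_low)
  have f0g: "trunc f0 + trunc g \<le> trunc (f0 * g)"
  proof -
    have "trunc (Q * (f0 * g1)) = trunc f0 + (Fin \<gamma> + trunc g1)"
      using IH2[of f0] degs(1)[of f] by (simp add: trunc_mult_Q f0_def ac_simps)
    then have "trunc f0 + trunc g \<le> min (trunc (f0 * g0)) (trunc (Q * (f0 * g1)))"
      using low_mult le by (simp add: add_left_mono)
    also have "\<dots> \<le> trunc (f0 * g0 + Q * (f0 * g1))" by (rule trunc_add)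
    also have "f0 * g0 + Q * (f0 * g1) = f0 * g" by (simp add: g algebra_simps)
    finally show ?thesis .
  qed
  have fg0: "trunc f + trunc g0 \<le> trunc (f * g0)"
  proof -
    have "trunc (Q * (f1 * g0)) = (Fin \<gamma> + trunc f1) + trunc g0"
      using IH1[of g0] degs(1)[of g] by (simp add: trunc_mult_Q g0_def ac_simps)
    then have "trunc f + trunc g0 \<le> min (trunc (f0 * g0)) (trunc (Q * (f1 * g0)))"
      using low_mult le by (simp add: add_right_mono)
    also have "\<dots> \<le> trunc (f0 * g0 + Q * (f1 * g0))" by (rule trunc_add)
    also have "f0 * g0 + Q * (f1 * g0) = f * g0" by (simp add: f algebra_simps)
    finally show ?thesis .
  qed
  have Qf1g: "trunc (Q * (f1 * g)) = (Fin \<gamma> + trunc f1) + trunc g"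
    using IH1[of g] by (simp add: trunc_mult_Q ac_simps)
  have Qfg1: "trunc (Q * (f * g1)) = trunc f + (Fin \<gamma> + trunc g1)"
    using IH2[of f] by (simp add: trunc_mult_Q ac_simps)
  have fg1: "f * g = Q * (f1 * g) + f0 * g"
    by (subst f) (simp add: algebra_simps)
  have fg2: "f * g = Q * (f * g1) + f * g0"
    by (subst g) (simp add: algebra_simps)
  have ge: "trunc f + trunc g \<le> trunc (f * g)"
  proof -
    have "trunc f + trunc g \<le> min (trunc (Q * (f1 * g))) (trunc (f0 * g))"
      using f0g add_right_mono[OF le(1), of "trunc g"] add_right_mono[OF le(2), of "trunc g"] 
      unfolding Qf1g by auto
    also have "\<dots> \<le> trunc (f * g)" unfolding fg1 by (rule trunc_add)
    finally show ?thesis .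
  qed
  have "trunc (f * g) \<le> trunc f + trunc g"
  proof (cases "f = 0 \<or> g = 0")
    case True
    then show ?thesis by auto
  next
    case False
    then have fin: "trunc f \<noteq> Pinf" "trunc g \<noteq> Pinf" by (auto simp: trunc_Pinf_iff)
    consider "trunc f < trunc f0" | "trunc g < trunc g0" | "trunc f = trunc f0" "trunc g = trunc g0"
      using le(1,3) by fastforce
    then show ?thesis
    proof cases
      case 1
      then have eq: "trunc f = Fin \<gamma> + trunc f1"
        using trunc_step[of f] low by (auto simp: f0_def f1_def trunc_low min_def split: if_splits)
      have "trunc (Q * (f1 * g)) < trunc f0 + trunc g"
        unfolding Qf1g eq[symmetric] using 1 fin by (intro extended_add_less_le) auto
      then have "trunc (Q * (f1 * g) + f0 * g) \<le> trunc (Q * (f1 * g))"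
        using f0g by (intro trunc_add_le) auto
      then show ?thesis unfolding fg1 Qf1g eq .
    next
      case 2
      then have eq: "trunc g = Fin \<gamma> + trunc g1"
        using trunc_step[of g] low by (auto simp: g0_def g1_def trunc_low min_def split: if_splits)
      have "trunc (Q * (f * g1)) < trunc f + trunc g0"
        unfolding Qfg1 eq[symmetric] using 2 fin by (intro extended_add_le_less) auto
      then have "trunc (Q * (f * g1) + f * g0) \<le> trunc (Q * (f * g1))"
        using fg0 by (intro trunc_add_le) auto
      then show ?thesis unfolding fg2 Qfg1 eq .
    next
      case 3
      have "f * g mod Q = f0 * g0 mod Q" by (simp add: f0_def g0_def mod_mult_eq)
      then have "trunc (f * g) \<le> u (f0 * g0 mod Q)" using trunc_step[of "f * g"] by simp
      also have "\<dots> = trunc f + trunc g"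
        using 3 low value_mod_mult[OF low] by (simp add: mult trunc_low)
      finally show ?thesis .
    qed
  qed
  with ge show ?case by simp
qed

lemma ring_valuation_trunc: "ring_valuation trunc"
  by unfold_locales (auto simp: trunc_Pinf_iff trunc_mult trunc_add)

end

section \<open>Key polynomials, augmentations and continuous families\<close>

lemma truncation_eq_aug:
  assumes "valuation w" and "w (to_rat Q) = Fin \<gamma>"
  shows "truncation w Q f = aug (\<lambda>f. w (to_rat f)) Q \<gamma> f"
proof -
  interpret ring_valuation "\<lambda>f. w (to_rat f)" using assms(1) by (rule ring_valuation_to_rat)
  show ?thesis
    unfolding truncation_def aug_def using power_eq[of Q \<gamma>] assms(2) by (simp add: mult)
qed

lemma is_augmentation_iff:
  "is_augmentation u \<phi> \<gamma> w \<longleftrightarrow> valuation w \<and> (\<forall>f. w (to_rat f) = aug u \<phi> \<gamma> f)"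
  by (simp add: is_augmentation_def aug_def)

lemma val_equiv_iff:
  assumes "valuation w"
  shows "val_equiv w f g \<longleftrightarrow> w (to_rat f) < w (to_rat (f - g))"
proof -
  interpret ring_valuation "\<lambda>f. w (to_rat f)" using assms(1) by (rule ring_valuation_to_rat)
  show ?thesis unfolding val_equiv_def using eq_of_diff_less[of f g] by auto
qed

text \<open>
  If the remainder had smaller value than \<open>f\<close>, then it would be equivalent to a multiple of \<open>\<phi>\<close>, which
  minimality forbids for a polynomial of smaller degree.
\<close>

lemma val_minimal_mod:
  assumes "valuation w" and "val_minimal w \<phi>" and "degree \<phi> > 0"
  shows "w (to_rat f) \<le> w (to_rat (f mod \<phi>))"
proof (rule ccontr)
  interpret ring_valuation "\<lambda>f. w (to_rat f)" using assms(1) by (rule ring_valuation_to_rat)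
  assume "\<not> ?thesis"
  then have less: "w (to_rat (f mod \<phi>)) < w (to_rat f)" by simp
  then have "f mod \<phi> \<noteq> 0" by auto
  moreover have "f mod \<phi> - \<phi> * - (f div \<phi>) = f" by simp
  then have "val_dvd w \<phi> (f mod \<phi>)"
    unfolding val_dvd_def val_equiv_iff[OF assms(1)] using less by metis
  ultimately have "degree \<phi> \<le> degree (f mod \<phi>)" using assms(2) by (auto simp: val_minimal_def)
  then show False using degree_exp_coeff[of \<phi> f 0] assms(3) by (simp add: exp_coeff_0)
qed

text \<open>
  Here \<open>Q\<close> is a monic polynomial of minimal degree whose value increases from \<open>u\<close> to \<open>w\<close>. A multiple of
  \<open>Q\<close> increases in value, and so does everything equivalent to one. Conversely, if the value of \<open>f\<close>
  increases, its remainder modulo \<open>Q\<close>, whose value does not, must have greater value than \<open>f\<close>, so \<open>f\<close>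
  is equivalent to a multiple of \<open>Q\<close>. Once divisibility is the same as an increase in value,
  irreducibility follows from multiplicativity and minimality from the choice of the degree.
\<close>

lemma Phi_key_polynomial:
  assumes u: "valuation u" and w: "valuation w"
    and le: "\<And>f. u (to_rat f) \<le> w (to_rat f)"
    and Q: "lead_coeff Q = 1" "degree Q > 0" "u (to_rat Q) < w (to_rat Q)"
    and low: "\<And>f. degree f < degree Q \<Longrightarrow> u (to_rat f) = w (to_rat f)"
  shows val_dvd_iff_less: "val_dvd u Q f \<longleftrightarrow> u (to_rat f) < w (to_rat f)"
    and "Q \<in> KP u"
proof -
  interpret u: ring_valuation "\<lambda>f. u (to_rat f)" using u by (rule ring_valuation_to_rat)
  interpret w: ring_valuation "\<lambda>f. w (to_rat f)" using w by (rule ring_valuation_to_rat)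
  have Qh: "u (to_rat (Q * h)) < w (to_rat (Q * h))" if "h \<noteq> 0" for h
    unfolding u.mult w.mult using Q(3) le u.finite_value[OF that]
    by (intro extended_add_less_le) auto
  have *: "val_dvd u Q f \<longleftrightarrow> u (to_rat f) < w (to_rat f)" for f
  proof
    assume "val_dvd u Q f"
    then obtain h where h: "u (to_rat f) < u (to_rat (f - Q * h))"
      by (auto simp: val_dvd_def val_equiv_iff[OF u])
    have eq: "u (to_rat (Q * h)) = u (to_rat f)" using u.eq_of_diff_less[OF h] .
    have "h \<noteq> 0" using h by auto
    then have "u (to_rat f) < min (w (to_rat (f - Q * h))) (w (to_rat (Q * h)))"
      using less_le_trans[OF h le] Qh[of h] eq by simp
    also have "\<dots> \<le> w (to_rat f)" using w.add_ge[of "f - Q * h" "Q * h"] by simp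
    finally show "u (to_rat f) < w (to_rat f)" .
  next
    assume less: "u (to_rat f) < w (to_rat f)"
    define r where "r = f mod Q"
    define h where "h = f div Q"
    have f: "f = r + Q * h" by (simp add: r_def h_def)
    have r: "u (to_rat r) = w (to_rat r)"
      using degree_exp_coeff[of Q f 0] Q(2) by (intro low) (simp add: exp_coeff_0 r_def)
    have "u (to_rat f) < u (to_rat r)"
    proof (rule ccontr)
      assume "\<not> ?thesis"
      then have le_r: "u (to_rat r) \<le> u (to_rat f)" by simp
      then have less_r: "w (to_rat r) < w (to_rat (r - - (Q * h)))" using less r f by simp
      have "u (to_rat (Q * h)) < w (to_rat (Q * h))"
        using less f r by (intro Qh) auto
      also have "w (to_rat (Q * h)) = u (to_rat r)"
        using w.eq_of_diff_less[OF less_r] r w.minus[of "Q * h"] by simp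
      finally have "u (to_rat (Q * h)) < u (to_rat r)" .
      then have "u (to_rat f) = u (to_rat (Q * h))"
        using u.add_eq[of "Q * h" r] f by (simp add: add.commute)
      then show False using le_r \<open>u (to_rat (Q * h)) < u (to_rat r)\<close> by simp
    qed
    moreover have "f - Q * h = r" using f by simp
    ultimately show "val_dvd u Q f"
      unfolding val_dvd_def val_equiv_iff[OF u] by metis
  qed
  then show "val_dvd u Q f \<longleftrightarrow> u (to_rat f) < w (to_rat f)" .
  have "val_irreducible u Q"
    unfolding val_irreducible_def * using le
    by (metis u.mult w.mult order.not_eq_order_implies_strict less_irrefl)
  moreover have "val_minimal u Q"
    unfolding val_minimal_def * using low by (metis less_irrefl not_le)
  ultimately show "Q \<in> KP u" using Q by (simp add: KP_def)
qed

context key_truncation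
begin

text \<open>
  Divisibility by \<open>Q\<close> for the truncation means that the digit of index 0 does not attain the value, and
  the value of the digit of index 0 is multiplicative by strictness. A key polynomial \<open>\<phi>\<close> of smaller
  degree cannot exist: by minimality its expansions would compute the truncation, whereas they
  underestimate the value of \<open>Q\<close>.
\<close>

lemma key_truncation_key_polynomial:
  assumes W: "valuation W" "\<And>f. W (to_rat f) = trunc f"
  shows "Q \<in> KP W" and "deg_val W = degree Q"
proof -
  interpret W: ring_valuation trunc by (rule ring_valuation_trunc)
  have dvd: "val_dvd W Q f \<longleftrightarrow> trunc f < u (f mod Q)" for f
  proof
    assume "val_dvd W Q f"
    then obtain h where "trunc f < trunc (f - Q * h)"
      by (auto simp: val_dvd_def val_equiv_iff[OF W(1)] W(2))
    also have "\<dots> \<le> u ((f - Q * h) mod Q)" using trunc_step[of "f - Q * h"] by simp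
    also have "(f - Q * h) mod Q = f mod Q" by (simp add: poly_mod_diff_left)
    finally show "trunc f < u (f mod Q)" .
  next
    assume "trunc f < u (f mod Q)"
    then have "trunc f < trunc (f - Q * (f div Q))"
      by (simp add: minus_mult_div_eq_mod trunc_low)
    then show "val_dvd W Q f"
      by (auto simp: val_dvd_def val_equiv_iff[OF W(1)] W(2))
  qed
  have le: "trunc f \<le> u (f mod Q)" for f using trunc_step[of f] by simp
  have "val_irreducible W Q"
    unfolding val_irreducible_def dvd
  proof (intro allI impI)
    fix f g
    assume less: "trunc (f * g) < u (f * g mod Q)"
    have "f * g mod Q = (f mod Q) * (g mod Q) mod Q" by (simp add: mod_mult_eq)
    then have "trunc f + trunc g < u (f mod Q) + u (g mod Q)"
      using less value_mod_mult[of "f mod Q" "g mod Q"] by (simp add: trunc_mult mult)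
    then show "trunc f < u (f mod Q) \<or> trunc g < u (g mod Q)"
      using le[of f] le[of g] by (auto simp: order.order_iff_strict)
  qed
  moreover have "val_minimal W Q"
    unfolding val_minimal_def dvd
  proof (intro allI impI)
    fix f assume "trunc f < u (f mod Q) \<and> f \<noteq> 0"
    then show "degree Q \<le> degree f"
      using trunc_low[of f] mod_poly_less[of f Q] by (cases "degree f < degree Q") auto
  qed
  ultimately show KP: "Q \<in> KP W" by (simp add: KP_def monic_Q)
  have min: "degree Q \<le> degree \<phi>" if "\<phi> \<in> KP W" for \<phi>
  proof (rule ccontr)
    assume "\<not> ?thesis"
    then have deg: "degree \<phi> < degree Q" by simp
    have \<phi>: "degree \<phi> > 0" "val_minimal W \<phi>" using that by (auto simp: KP_def)
    have "\<phi> \<noteq> 0" using \<phi>(1) by auto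
    then obtain \<beta> where \<beta>: "u \<phi> = Fin \<beta>" using finite_value by blast
    \<comment> \<open>The two expansions of \<open>Q\<close> in powers of \<open>\<phi>\<close> agree because their digits are short.\<close>
    have "trunc Q \<le> aug trunc \<phi> \<beta> Q"
      using val_minimal_mod[OF W(1) \<phi>(2,1)] deg \<phi>(1) \<beta>
      by (intro valuation_le_aug W.ring_valuation_axioms) (auto simp: W(2) trunc_low)
    also have "aug trunc \<phi> \<beta> Q = aug u \<phi> \<beta> Q"
      using deg \<phi>(1) by (intro aug_cong) (auto simp: trunc_low)
    also have "\<dots> < u (Q - Q mod Q)"
      using strict deg \<phi>(1) \<beta> by (intro aug_less_of_strict_reduction ring_valuation_axioms) auto
    finally show False by (simp add: trunc_Q value_Q)
  qed
  show "deg_val W = degree Q"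
    unfolding deg_val_def by (rule Least_equality) (use KP min in auto)
qed

end

lemma ordinary_aug_facts:
  assumes "ordinary_aug w' \<phi> \<gamma> w"
  shows ordinary_aug_valuation: "valuation w'" "valuation w"
    and ordinary_aug_degree: "degree \<phi> > 0"
    and ordinary_aug_eq: "w (to_rat f) = aug (\<lambda>f. w' (to_rat f)) \<phi> \<gamma> f"
    and ordinary_aug_mono: "w' (to_rat f) \<le> w (to_rat f)"
    and ordinary_aug_low: "degree f < degree \<phi> \<Longrightarrow> w (to_rat f) = w' (to_rat f)"
    and ordinary_aug_key: "w (to_rat \<phi>) = Fin \<gamma>"
    and ordinary_aug_less: "w' (to_rat \<phi>) < Fin \<gamma>"
proof -
  show w': "valuation w'" and "valuation w" and \<phi>: "degree \<phi> > 0"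
    and eq: "w (to_rat f) = aug (\<lambda>f. w' (to_rat f)) \<phi> \<gamma> f" 
    and less: "w' (to_rat \<phi>) < Fin \<gamma>" for f
    using assms by (auto simp: ordinary_aug_def is_augmentation_iff KP_def)
  interpret ring_valuation "\<lambda>f. w' (to_rat f)" using w' by (rule ring_valuation_to_rat)
  have min: "val_minimal w' \<phi>" using assms by (auto simp: ordinary_aug_def KP_def)
  show "w' (to_rat f) \<le> w (to_rat f)"
    unfolding eq using val_minimal_mod[OF w' min \<phi>] less \<phi>
    by (intro valuation_le_aug ring_valuation_axioms) auto
  show "degree f < degree \<phi> \<Longrightarrow> w (to_rat f) = w' (to_rat f)"
    unfolding eq by (simp add: aug_low)
  show "w (to_rat \<phi>) = Fin \<gamma>"
    using aug_mult_key[of "\<lambda>f. w' (to_rat f)" \<phi> \<gamma> 1] \<phi> aug_low[of "\<lambda>f. w' (to_rat f)" 1 \<phi> \<gamma>]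
    by (simp add: eq flip: zero_extended_def)
qed

lemma stable_eventually:
  assumes "stable A \<rho> f"
  obtains i0 where "i0 \<in> A" "\<And>i. i \<in> A \<Longrightarrow> i0 \<le> i \<Longrightarrow> \<rho> i (to_rat f) = stable_value A \<rho> f"
proof -
  obtain i0 where i0: "i0 \<in> A" "\<forall>i\<in>A. i0 \<le> i \<longrightarrow> \<rho> i (to_rat f) = \<rho> i0 (to_rat f)"
    using assms by (auto simp: stable_def)
  have "stable_value A \<rho> f = \<rho> i0 (to_rat f)"
    unfolding stable_value_def
  proof (rule the_equality)
    show "\<exists>i0'\<in>A. \<forall>i\<in>A. i0' \<le> i \<longrightarrow> \<rho> i (to_rat f) = \<rho> i0 (to_rat f)" using i0 by blast
    fix x assume "\<exists>i1\<in>A. \<forall>i\<in>A. i1 \<le> i \<longrightarrow> \<rho> i (to_rat f) = x"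
    then obtain i1 where i1: "i1 \<in> A" "\<forall>i\<in>A. i1 \<le> i \<longrightarrow> \<rho> i (to_rat f) = x" by blast
    have "max i0 i1 \<in> A" using i0 i1 by (simp add: max_def)
    then show "x = \<rho> i0 (to_rat f)" using i0 i1 by (metis max.cobounded1 max.cobounded2)
  qed
  then show ?thesis using that i0 by metis
qed

lemma stable_valueI:
  assumes "i0 \<in> A" and "\<And>i. i \<in> A \<Longrightarrow> i0 \<le> i \<Longrightarrow> \<rho> i (to_rat f) = x"
  shows "stable A \<rho> f" and "stable_value A \<rho> f = x"
proof -
  show st: "stable A \<rho> f" using assms by (auto simp: stable_def)
  obtain i1 where i1: "i1 \<in> A" "\<And>i. i \<in> A \<Longrightarrow> i1 \<le> i \<Longrightarrow> \<rho> i (to_rat f) = stable_value A \<rho> f"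
    using stable_eventually[OF st] by blast
  have "max i0 i1 \<in> A" using assms i1 by (simp add: max_def)
  then show "stable_value A \<rho> f = x" using assms i1 by (metis max.cobounded1 max.cobounded2)
qed

lemma stable_if_degree_less_m_inf:
  assumes "enat (degree f) < m_inf A \<rho>"
  shows "stable A \<rho> f"
  using assms unfolding m_inf_def by (metis (mono_tags, lifting) INF_lower mem_Collect_eq not_le)

lemma continuous_family_facts:
  assumes "continuous_family w' m A \<chi> \<beta> \<rho>"
  shows continuous_family_le_stable_value:
      "i \<in> A \<Longrightarrow> stable A \<rho> f \<Longrightarrow> \<rho> i (to_rat f) \<le> stable_value A \<rho> f"
    and continuous_family_low:
      "degree f < m \<Longrightarrow> stable A \<rho> f \<and> stable_value A \<rho> f = w' (to_rat f)"
proof -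
  show "\<rho> i (to_rat f) \<le> stable_value A \<rho> f" if i: "i \<in> A" and st: "stable A \<rho> f"
  proof -
    obtain i0 where i0: "i0 \<in> A" "\<And>i. i \<in> A \<Longrightarrow> i0 \<le> i \<Longrightarrow> \<rho> i (to_rat f) = stable_value A \<rho> f"
      using stable_eventually[OF st] by blast
    show ?thesis
    proof (cases "i0 \<le> i")
      case False
      then have "ordinary_aug (\<rho> i) (\<chi> i0) (\<beta> i0) (\<rho> i0)"
        using assms i i0(1) by (simp add: continuous_family_def)
      from ordinary_aug_mono[OF this, of f] show ?thesis using i0 by simp
    qed (use i i0 in simp)
  qed
  assume "degree f < m"
  obtain i0 where "i0 \<in> A" using assms by (auto simp: continuous_family_def)
  moreover have "\<rho> i (to_rat f) = w' (to_rat f)" if "i \<in> A" for i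
    using assms that \<open>degree f < m\<close> by (intro ordinary_aug_low) (auto simp: continuous_family_def)
  ultimately show "stable A \<rho> f \<and> stable_value A \<rho> f = w' (to_rat f)"
    using stable_valueI[of i0 A \<rho> f] by blast
qed

text \<open>
  In a limit step the value of any \<open>\<chi> i\<close> increases, and its degree is less than that of \<open>\<phi>\<close>; an
  ordinary step leaves the values of all such polynomials unchanged.
\<close>

lemma ordinary_aug_not_limit_aug:
  assumes ord: "ordinary_aug w' \<phi> \<gamma> w"
  shows "\<not> limit_aug w' \<phi> \<gamma> w"
proof
  assume "limit_aug w' \<phi> \<gamma> w"
  then obtain m and A :: "'b set" and \<chi> \<beta> \<rho> where fam: "continuous_family w' m A \<chi> \<beta> \<rho>"
    and m: "enat m < m_inf A \<rho>" and \<phi>: "\<phi> \<in> KP_inf A \<rho>"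
    and w: "\<And>f. w (to_rat f) = aug (stable_value A \<rho>) \<phi> \<gamma> f"
    unfolding limit_aug_def is_augmentation_iff by blast
  obtain i where i: "i \<in> A" using fam by (auto simp: continuous_family_def)
  have step: "ordinary_aug w' (\<chi> i) (\<beta> i) (\<rho> i)" and deg: "degree (\<chi> i) = m"
    using fam i by (auto simp: continuous_family_def)
  have less: "degree (\<chi> i) < degree \<phi>" using m \<phi> deg by (simp add: KP_inf_def flip: enat_ord_simps(2))
  have "m > 0" using ordinary_aug_degree[OF step] deg by simp
  then have zero: "stable_value A \<rho> 0 = Pinf"
    using continuous_family_low[OF fam, of 0] ordinary_aug_valuation(1)[OF ord] 
    by (simp add: valuation_def to_rat_eq_0_iff)
  have "w' (to_rat (\<chi> i)) < Fin (\<beta> i)" by (rule ordinary_aug_less[OF step])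
  also have "\<dots> = \<rho> i (to_rat (\<chi> i))" using ordinary_aug_key[OF step] by simp
  also have "\<dots> \<le> stable_value A \<rho> (\<chi> i)"
    using m deg by (intro continuous_family_le_stable_value[OF fam i] stable_if_degree_less_m_inf) auto
  also have "\<dots> = w (to_rat (\<chi> i))" unfolding w using less zero by (simp add: aug_low)
  also have "\<dots> = w' (to_rat (\<chi> i))" by (rule ordinary_aug_low[OF ord less])
  finally show False by simp
qed

text \<open>
  The bound is the degree \<open>m\<close> of the family. The limit \<open>w\<close> gives \<open>Q\<close> the value that some member of the
  family gives it, that is, a value computed from an expansion in powers of \<open>\<chi> i\<close>; if \<open>Q\<close> had degree
  greater than \<open>m\<close>, this expansion would underestimate \<open>w Q\<close>.
\<close>

lemma degree_le_of_limit_of_continuous_family: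
  assumes "limit_of_continuous_family w' w"
  shows "\<exists>m. \<forall>Q. strict_reduction (\<lambda>f. w (to_rat f)) Q \<longrightarrow> degree Q \<le> m"
proof -
  obtain m and A :: "'b set" and \<chi> \<beta> \<rho> where fam: "continuous_family w' m A \<chi> \<beta> \<rho>"
    and lim: "stable_limit A \<rho> w"
    using assms by (auto simp: limit_of_continuous_family_def)
  have stable: "stable A \<rho> f" and w: "w (to_rat f) = stable_value A \<rho> f" for f
    using lim by (auto simp: stable_limit_def)
  interpret ring_valuation "\<lambda>f. w (to_rat f)"
    using lim by (intro ring_valuation_to_rat) (simp add: stable_limit_def)
  have "degree Q \<le> m" if Q: "strict_reduction (\<lambda>f. w (to_rat f)) Q" for Q
  proof (rule ccontr)
    assume m: "\<not> degree Q \<le> m"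
    obtain i where i: "i \<in> A" "\<rho> i (to_rat Q) = w (to_rat Q)"
      using stable_eventually[OF stable[of Q]] w by (metis order_refl)
    have step: "ordinary_aug w' (\<chi> i) (\<beta> i) (\<rho> i)" and deg: "degree (\<chi> i) = m"
      using fam i by (auto simp: continuous_family_def)
    have pos: "degree (\<chi> i) > 0" by (rule ordinary_aug_degree[OF step])
    have "Fin (\<beta> i) = \<rho> i (to_rat (\<chi> i))" using ordinary_aug_key[OF step] by simp
    also have "\<dots> \<le> w (to_rat (\<chi> i))"
      unfolding w by (rule continuous_family_le_stable_value[OF fam i(1) stable])
    finally have \<beta>: "Fin (\<beta> i) \<le> w (to_rat (\<chi> i))" .
    have "w (to_rat Q) = aug (\<lambda>f. w' (to_rat f)) (\<chi> i) (\<beta> i) Q"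
      using ordinary_aug_eq[OF step] i(2) by simp
    also have "\<dots> = aug (\<lambda>f. w (to_rat f)) (\<chi> i) (\<beta> i) Q"
      using continuous_family_low[OF fam] deg pos by (intro aug_cong) (auto simp: w)
    also have "\<dots> < w (to_rat (Q - Q mod Q))"
      using pos m deg \<beta> Q
      by (intro aug_less_of_strict_reduction[where u = "\<lambda>f. w (to_rat f)"] ring_valuation_axioms) auto
    finally show False by simp
  qed
  then show ?thesis by blast
qed

lemma val_leI:
  assumes w': "valuation w'" and w: "valuation w"
    and le: "\<And>f. w' (to_rat f) \<le> w (to_rat f)"
    and attained: "\<And>f. f \<noteq> 0 \<Longrightarrow> \<exists>g. w' (to_rat f) = w (to_rat g)"
  shows "val_le w' w"
proof -
  interpret w': ring_valuation w' using w' by (simp add: valuation_iff)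
  interpret w: ring_valuation w using w by (simp add: valuation_iff)
  have "val_group w' \<subseteq> val_group w"
  proof
    fix a assume "a \<in> val_group w'"
    then obtain x where x: "x \<noteq> 0" "w' x = Fin a" by (auto simp: val_group_def)
    obtain p q :: "'a poly" where pq: "x = Fraction_Field.Fract p q" "q \<noteq> 0" by (cases x)
    then have xpq: "x * to_rat q = to_rat p" by (simp add: to_rat_def eq_fract)
    then have "p \<noteq> 0" using x(1) pq(2) to_rat_eq_0_iff by (metis no_zero_divisors)
    then obtain f g where fg: "w' (to_rat p) = w (to_rat f)" "w' (to_rat q) = w (to_rat g)"
      using attained pq(2) by metis
    obtain b where b: "w' (to_rat q) = Fin b"
      using w'.finite_value[of "to_rat q"] pq(2) by (auto simp: to_rat_eq_0_iff)
    have val_p: "w' (to_rat p) = Fin (a + b)" using x(2) b w'.mult[of x "to_rat q"] xpq by simp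
    have "g \<noteq> 0" using b fg w.zero to_rat_eq_0_iff[of g] by (metis extended.distinct(1))
    have "f \<noteq> 0" using val_p fg w.zero to_rat_eq_0_iff[of f] by (metis extended.distinct(1))
    define y where "y = to_rat f / to_rat g"
    have y: "y \<noteq> 0" "y * to_rat g = to_rat f"
      using \<open>f \<noteq> 0\<close> \<open>g \<noteq> 0\<close> by (auto simp: y_def to_rat_eq_0_iff)
    then have "w y + Fin b = Fin (a + b)"
      using w.mult[of y "to_rat g"] b val_p fg by simp
    then have "w y = Fin a" by (cases "w y") auto
    then show "a \<in> val_group w" using y(1) by (auto simp: val_group_def)
  qed
  then show ?thesis using le by (simp add: val_le_def)
qed

lemma deg_Phi_eqI:
  assumes "lead_coeff g = 1" and "w' (to_rat g) < w (to_rat g)" and "degree g = d"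
    and "\<And>f. degree f < d \<Longrightarrow> w' (to_rat f) = w (to_rat f)"
  shows "deg_Phi w' w = d"
  unfolding deg_Phi_def by (rule Least_equality) (use assms in \<open>auto simp: not_less[symmetric]\<close>)

section \<open>Reduction modulo an abstract key polynomial\<close>

text \<open>
  For a linear factor \<open>X - \<beta>\<close> the difference is \<open>X - \<alpha>\<close>, and the property passes to products.
\<close>

lemma evaluation_approximates:
  fixes wbar :: "('l::alg_closed_field, 'g::linordered_ab_group_add) ratval"
  assumes "valuation wbar" and "F \<noteq> 0"
    and "\<And>\<beta>. poly F \<beta> = 0 \<Longrightarrow> wbar (to_rat [:- \<beta>, 1:]) < wbar (to_rat [:- \<alpha>, 1:])"
  shows "wbar (to_rat F) < wbar (to_rat (F - [:poly F \<alpha>:]))"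
  using assms(2,3)
proof (induction "degree F" arbitrary: F)
  case 0
  interpret ring_valuation "\<lambda>f. wbar (to_rat f)" using assms(1) by (rule ring_valuation_to_rat)
  obtain a where "F = [:a:]" using 0 by (metis degree_eq_zeroE)
  then show ?case using finite_value[of F] 0 by auto
next
  case (Suc n)
  interpret ring_valuation "\<lambda>f. wbar (to_rat f)" using assms(1) by (rule ring_valuation_to_rat)
  obtain \<beta> where \<beta>: "poly F \<beta> = 0"
    using alg_closed_imp_poly_has_root[of F] Suc.hyps(2) by auto
  then obtain G where F: "F = [:- \<beta>, 1:] * G" by (metis dvd_def poly_eq_0_iff_dvd)
  have "G \<noteq> 0" using F Suc.prems(1) by auto
  then have "degree F = Suc (degree G)" unfolding F by (subst degree_mult_eq) auto
  then have G: "wbar (to_rat G) < wbar (to_rat (G - [:poly G \<alpha>:]))"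
    using Suc.hyps \<open>G \<noteq> 0\<close> Suc.prems(2) F by (intro Suc.hyps(1)) auto
  have "[:poly F \<alpha>:] = ([:- \<beta>, 1:] - [:- \<alpha>, 1:]) * [:poly G \<alpha>:]"
    by (simp add: F left_diff_distrib right_diff_distrib mult.commute[of _ "poly G \<alpha>"])
  then have "F - [:poly F \<alpha>:] = [:- \<beta>, 1:] * (G - [:poly G \<alpha>:]) + [:poly G \<alpha>:] * [:- \<alpha>, 1:]"
    unfolding F by (simp only: left_diff_distrib right_diff_distrib mult.commute diff_add_eq diff_diff_eq2)
  moreover have "wbar (to_rat F) < wbar (to_rat ([:- \<beta>, 1:] * (G - [:poly G \<alpha>:])))"
    unfolding F mult using G finite_value[of "[:- \<beta>, 1:]"] by (intro extended_add_le_less) auto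
  moreover have "wbar (to_rat F) < wbar (to_rat ([:poly G \<alpha>:] * [:- \<alpha>, 1:]))"
    unfolding F mult eq_of_diff_less[OF G] using Suc.prems(2)[OF \<beta>] finite_value[OF \<open>G \<noteq> 0\<close>]
    by (subst add.commute) (intro extended_add_le_less, auto)
  ultimately show ?case by (simp only: less_add)
qed

lemma map_poly_to_ac_mult: "map_poly to_ac (f * g) = map_poly to_ac f * map_poly to_ac g"
  and map_poly_to_ac_add: "map_poly to_ac (f + g) = map_poly to_ac f + map_poly to_ac g"
  and map_poly_to_ac_diff: "map_poly to_ac (f - g) = map_poly to_ac f - map_poly to_ac g"
  and map_poly_to_ac_eq_0_iff: "map_poly to_ac f = 0 \<longleftrightarrow> f = 0"
  by (simp_all add: poly_eq_iff coeff_map_poly coeff_mult to_ac_sum)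

lemma finite_root_values:
  assumes "f \<noteq> 0"
  shows "finite {wbar (to_rat [:- \<alpha>, 1:]) | \<alpha>. poly (map_poly to_ac f) \<alpha> = 0}"
proof -
  have "{wbar (to_rat [:- \<alpha>, 1:]) | \<alpha>. poly (map_poly to_ac f) \<alpha> = 0} =
      (\<lambda>\<alpha>. wbar (to_rat [:- \<alpha>, 1:])) ` {\<alpha>. poly (map_poly to_ac f) \<alpha> = 0}" by blast
  then show ?thesis using poly_roots_finite[of "map_poly to_ac f"] assms
    by (simp add: map_poly_to_ac_eq_0_iff)
qed

lemma delta_ge:
  assumes "f \<noteq> 0" and "poly (map_poly to_ac f) \<alpha> = 0"
  shows "wbar (to_rat [:- \<alpha>, 1:]) \<le> delta wbar f"
  unfolding delta_def using assms by (intro Max_ge finite_root_values) auto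

lemma delta_attained:
  fixes f :: "'a::field poly"
  assumes "degree f > 0"
  obtains \<alpha> where "poly (map_poly to_ac f) \<alpha> = 0" and "delta wbar f = wbar (to_rat [:- \<alpha>, 1:])"
proof -
  have "f \<noteq> 0" using assms by auto
  have "degree (map_poly to_ac f) > 0" using assms by (subst degree_map_poly) auto
  then obtain \<beta> where "poly (map_poly to_ac f) \<beta> = 0"
    using alg_closed_imp_poly_has_root by blast
  then have "delta wbar f \<in> {wbar (to_rat [:- \<alpha>, 1:]) | \<alpha>. poly (map_poly to_ac f) \<alpha> = 0}"
    unfolding delta_def using finite_root_values[OF \<open>f \<noteq> 0\<close>] by (intro Max_in) auto
  then show ?thesis using that by blast
qed

text \<open>
  Below the degree of \<open>Q\<close> every polynomial is approximated by its value at the root \<open>\<alpha>\<close> of \<open>Q\<close> that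
  attains \<open>delta wbar Q\<close>. The product \<open>f * g\<close> inherits this from its factors, the remainder has it as
  a polynomial of small degree, and both take the same value at \<open>\<alpha>\<close>.
\<close>

lemma strict_reduction_of_abkp:
  assumes w: "valuation w" and ext: "common_extension vbar w wbar" and Q: "abkp wbar Q"
  shows "strict_reduction (\<lambda>f. w (to_rat f)) Q"
proof -
  have wbar: "valuation wbar" using ext by (auto simp: common_extension_def extends_to_rat_def)
  interpret b: ring_valuation "\<lambda>f. wbar (to_rat f)" using wbar by (rule ring_valuation_to_rat)
  let ?m = "map_poly to_ac"
  have degQ: "degree Q > 0" using Q by (simp add: abkp_def)
  have one: "?m 1 = 1" by (simp add: poly_eq_iff coeff_map_poly)
  have frac: "wbar (Fraction_Field.Fract (?m p) (?m q)) = w (Fraction_Field.Fract p q)"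
    if "q \<noteq> 0" for p q
    using ext that unfolding common_extension_def by blast
  have w_eq: "w (to_rat f) = wbar (to_rat (?m f))" for f
    using frac[of 1 f] one by (simp add: to_rat_def)
  obtain \<alpha> where \<alpha>: "poly (?m Q) \<alpha> = 0" "delta wbar Q = wbar (to_rat [:- \<alpha>, 1:])"
    by (rule delta_attained[OF degQ])
  have approx: "wbar (to_rat (?m f)) < wbar (to_rat (?m f - [:poly (?m f) \<alpha>:]))"
    if "f \<noteq> 0" "degree f < degree Q" for f
  proof (rule evaluation_approximates[OF wbar])
    show "?m f \<noteq> 0" using that(1) by (simp add: map_poly_to_ac_eq_0_iff)
    fix \<beta> assume root: "poly (?m f) \<beta> = 0"
    have "degree f > 0"
    proof (rule ccontr)
      assume "\<not> degree f > 0"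
      then obtain a where "f = [:a:]" by (metis degree_eq_zeroE not_gr_zero)
      then show False using root that(1) by (simp add: map_poly_pCons)
    qed
    then have "delta wbar f < delta wbar Q" using Q that(2) by (simp add: abkp_def)
    then show "wbar (to_rat [:- \<beta>, 1:]) < wbar (to_rat [:- \<alpha>, 1:])"
      using delta_ge[OF that(1) root] \<alpha>(2) by (metis le_less_trans)
  qed
  have "w (to_rat (f * g)) < w (to_rat (f * g - f * g mod Q))"
    if f: "f \<noteq> 0" "degree f < degree Q" and g: "g \<noteq> 0" "degree g < degree Q" for f g
  proof -
    define F G r R where "F = ?m f" and "G = ?m g" and "r = f * g mod Q" and "R = ?m r"
    note Fa = approx[OF f, folded F_def] and Ga = approx[OF g, folded G_def]
    have FG: "wbar (to_rat (F * G)) < wbar (to_rat (F * G - [:poly (F * G) \<alpha>:]))"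
    proof -
      have "[:poly (F * G) \<alpha>:] = [:poly G \<alpha>:] * [:poly F \<alpha>:]" by simp
      then have "F * G - [:poly (F * G) \<alpha>:] =
          F * (G - [:poly G \<alpha>:]) + [:poly G \<alpha>:] * (F - [:poly F \<alpha>:])"
        by (simp only: right_diff_distrib mult.commute diff_add_eq diff_diff_eq2) simp
      moreover have "wbar (to_rat (F * G)) < wbar (to_rat (F * (G - [:poly G \<alpha>:])))"
        unfolding b.mult using Ga Fa by (intro extended_add_le_less) auto
      moreover have "wbar (to_rat (F * G)) < wbar (to_rat ([:poly G \<alpha>:] * (F - [:poly F \<alpha>:])))"
        unfolding b.mult b.eq_of_diff_less[OF Ga] using Ga Fa
        by (subst add.commute) (intro extended_add_le_less, auto)
      ultimately show ?thesis by (simp only: b.less_add)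
    qed
    have split: "F * G = ?m (f * g div Q) * ?m Q + R"
      unfolding F_def G_def R_def r_def map_poly_to_ac_mult[symmetric] map_poly_to_ac_add[symmetric]
      by simp
    have eval: "poly R \<alpha> = poly (F * G) \<alpha>"
      unfolding split using \<alpha>(1) by simp
    have "r \<noteq> 0"
    proof
      assume "r = 0"
      then have "poly (F * G) \<alpha> = 0" using eval by (simp add: R_def)
      then show False using FG by (simp del: poly_mult)
    qed
    moreover have "degree r < degree Q"
      using degree_exp_coeff[of Q "f * g" 0] degQ by (simp add: exp_coeff_0 r_def)
    ultimately have Ra: "wbar (to_rat R) < wbar (to_rat (R - [:poly (F * G) \<alpha>:]))"
      using approx[of r] eval by (simp add: R_def)
    have "wbar (to_rat (F * G)) = wbar (to_rat R)"
      using b.eq_of_diff_less[OF FG] b.eq_of_diff_less[OF Ra] by simp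
    then have "wbar (to_rat (F * G)) < wbar (to_rat (F * G - R))"
      using b.less_diff[OF FG, of "R - [:poly (F * G) \<alpha>:]"] Ra by simp
    then show ?thesis
      by (simp add: w_eq map_poly_to_ac_mult map_poly_to_ac_diff F_def G_def R_def r_def)
  qed
  then show ?thesis using Q by (simp add: strict_reduction_def abkp_def)
qed

section \<open>Truncations along a complete sequence\<close>

text \<open>
  The part of the notion of a complete sequence that the construction of the augmentations uses,
  expressed in \<open>K[X]\<close>.
\<close>

locale key_sequence =
  fixes w :: "('a::field, 'g::linordered_ab_group_add) ratval"
    and D :: "'i::linorder set" and Q :: "'i \<Rightarrow> 'a poly"
  assumes valuation_w: "valuation w"
    and strict: "i \<in> D \<Longrightarrow> strict_reduction (\<lambda>f. w (to_rat f)) (Q i)"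
    and degree_mono: "i \<in> D \<Longrightarrow> j \<in> D \<Longrightarrow> i < j \<Longrightarrow> degree (Q i) \<le> degree (Q j)"
    and value_less: "i \<in> D \<Longrightarrow> j \<in> D \<Longrightarrow> i < j \<Longrightarrow> w (to_rat (Q i)) < w (to_rat (Q j))"
    and complete: "degree f > 0 \<Longrightarrow>
      \<exists>i\<in>D. degree (Q i) \<le> degree f \<and> truncation w (Q i) f = w (to_rat f)"
begin

sublocale w: ring_valuation "\<lambda>f. w (to_rat f)"
  by (rule ring_valuation_to_rat[OF valuation_w])

definition key_value :: "'i \<Rightarrow> 'g" where
  "key_value i = (THE g. w (to_rat (Q i)) = Fin g)"

definition key_val :: "'i \<Rightarrow> ('a, 'g) ratval" where
  "key_val i = fract_valuation (aug (\<lambda>f. w (to_rat f)) (Q i) (key_value i))"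

lemma degree_key: "i \<in> D \<Longrightarrow> degree (Q i) > 0"
  and monic_key: "i \<in> D \<Longrightarrow> lead_coeff (Q i) = 1"
  using strict by (auto simp: strict_reduction_def)

lemma value_key:
  assumes "i \<in> D"
  shows "w (to_rat (Q i)) = Fin (key_value i)"
proof -
  have "Q i \<noteq> 0" using degree_key[OF assms] by auto
  then obtain g where "w (to_rat (Q i)) = Fin g" using w.finite_value by blast
  then show ?thesis by (simp add: key_value_def)
qed

lemma key_value_less: "i \<in> D \<Longrightarrow> j \<in> D \<Longrightarrow> i < j \<Longrightarrow> key_value i < key_value j"
  using value_less[of i j] by (simp add: value_key)

lemma key_truncation: "i \<in> D \<Longrightarrow> key_truncation (\<lambda>f. w (to_rat f)) (Q i) (key_value i)"
  by unfold_locales (simp_all add: strict value_key)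

lemma valuation_key_val: "i \<in> D \<Longrightarrow> valuation (key_val i)"
  unfolding key_val_def
  by (intro valuation_fract_valuation key_truncation.ring_valuation_trunc key_truncation)

lemma key_val_eq:
  "i \<in> D \<Longrightarrow> key_val i (to_rat f) = aug (\<lambda>f. w (to_rat f)) (Q i) (key_value i) f"
  unfolding key_val_def
  by (intro fract_valuation_to_rat key_truncation.ring_valuation_trunc key_truncation)

lemma ring_valuation_key_val: "i \<in> D \<Longrightarrow> ring_valuation (\<lambda>f. key_val i (to_rat f))"
  by (intro ring_valuation_to_rat valuation_key_val)

lemma key_val_low: "i \<in> D \<Longrightarrow> degree f < degree (Q i) \<Longrightarrow> key_val i (to_rat f) = w (to_rat f)"
  by (simp add: key_val_eq aug_low)

lemma key_val_key: "i \<in> D \<Longrightarrow> key_val i (to_rat (Q i)) = Fin (key_value i)"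
  by (simp add: key_val_eq key_truncation.trunc_Q[OF key_truncation])

lemma key_val_le: "i \<in> D \<Longrightarrow> key_val i (to_rat f) \<le> w (to_rat f)"
  by (simp add: key_val_eq key_truncation.trunc_le[OF key_truncation])

lemma key_val_KP: "i \<in> D \<Longrightarrow> Q i \<in> KP (key_val i)"
  and deg_key_val: "i \<in> D \<Longrightarrow> deg_val (key_val i) = degree (Q i)"
  using key_truncation.key_truncation_key_polynomial[OF key_truncation valuation_key_val] key_val_eq
  by blast+

lemma degree_key_diff:
  assumes "i \<in> D" and "j \<in> D" and "degree (Q i) = degree (Q j)"
  shows "degree (Q i - Q j) < degree (Q j)"
proof (cases "Q i - Q j = 0")
  case False
  have "degree (Q i - Q j) \<le> degree (Q j)" using assms(3) by (intro degree_diff_le) auto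
  moreover have "coeff (Q i - Q j) (degree (Q j)) = 0"
    using monic_key[OF assms(1)] monic_key[OF assms(2)] assms(3) by simp
  ultimately show ?thesis
    using False leading_coeff_0_iff[of "Q i - Q j"] by (metis le_neq_implies_less)
qed (use degree_key assms in simp)

lemma value_key_diff:
  assumes "i \<in> D" and "j \<in> D" and "i < j"
  shows "w (to_rat (Q i - Q j)) = Fin (key_value i)"
  using w.add_eq[of "Q i" "- Q j"] value_less[OF assms] value_key[OF assms(1)] by simp

text \<open>
  In equal degree, \<open>Q i\<close> is \<open>Q j\<close> plus a polynomial of smaller degree, and the latter has the value of
  \<open>Q i\<close> because \<open>Q j\<close> has a greater one.
\<close>

lemma key_val_previous_key:
  assumes "i \<in> D" and "j \<in> D" and "i < j"
  shows "key_val j (to_rat (Q i)) = Fin (key_value i)"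
proof (cases "degree (Q i) < degree (Q j)")
  case True
  then show ?thesis using assms by (simp add: key_val_low value_key)
next
  case False
  interpret j: ring_valuation "\<lambda>f. key_val j (to_rat f)" by (rule ring_valuation_key_val) fact
  have "key_val j (to_rat (Q i - Q j)) = Fin (key_value i)"
    using False degree_mono[OF assms] degree_key_diff[of i j] assms
    by (simp add: key_val_low value_key_diff)
  then show ?thesis
    using j.add_eq[of "Q i - Q j" "Q j"] assms by (simp add: key_val_key key_value_less)
qed

lemma key_val_next_key:
  assumes "i \<in> D" and "j \<in> D" and "i < j" and deg: "degree (Q i) = degree (Q j)"
  shows "key_val i (to_rat (Q j)) = Fin (key_value i)"
proof -
  interpret key_truncation "\<lambda>f. w (to_rat f)" "Q i" "key_value i" by (rule key_truncation) fact
  interpret i: ring_valuation trunc by (rule ring_valuation_trunc)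
  have low: "degree (Q j - Q i) < degree (Q i)"
    using degree_key_diff[of j i] assms by simp
  have diff: "w (to_rat (Q j - Q i)) = Fin (key_value i)"
    using value_key_diff[OF assms(1-3)] w.diff_commute by simp
  have "Q j mod Q i = (Q j - Q i + Q i) mod Q i" by simp
  also have "\<dots> = Q j - Q i" using low by (simp only: mod_add_self2 mod_poly_less)
  finally have "trunc (Q j) \<le> Fin (key_value i)" using trunc_step[of "Q j"] diff by simp
  moreover have "Fin (key_value i) \<le> trunc (Q j)"
    using i.add_ge[of "Q j - Q i" "Q i"] low diff trunc_Q by (simp add: trunc_low)
  ultimately show ?thesis using assms by (simp add: key_val_eq)
qed

lemma key_val_less_later_key:
  assumes "i \<in> D" and "j \<in> D" and "i < j"
  shows "key_val i (to_rat (Q j)) < w (to_rat (Q j))"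
proof (cases "degree (Q i) = degree (Q j)")
  case True
  then show ?thesis using assms by (simp add: key_val_next_key value_key key_value_less)
next
  case False
  then have "degree (Q i) < degree (Q j)" using degree_mono[OF assms] by simp
  then have "aug (\<lambda>f. w (to_rat f)) (Q i) (key_value i) (Q j) < w (to_rat (Q j - Q j mod Q j))"
    using assms strict degree_key value_key 
    by (intro aug_less_of_strict_reduction[where u = "\<lambda>f. w (to_rat f)"] w.ring_valuation_axioms) auto
  then show ?thesis using assms by (simp add: key_val_eq)
qed

lemma key_val_mono:
  assumes "i \<in> D" and "j \<in> D" and "i \<le> j"
  shows "key_val i (to_rat f) \<le> key_val j (to_rat f)"
proof (cases "i = j")
  case False
  then have "i < j" using assms by simp
  have "aug (\<lambda>f. w (to_rat f)) (Q i) (key_value i) f \<le> key_val j (to_rat f)"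
    using assms degree_mono[OF assms(1,2) \<open>i < j\<close>] key_val_previous_key[OF assms(1,2) \<open>i < j\<close>]
    by (intro aug_le_valuation ring_valuation_key_val) (auto simp: degree_key key_val_low)
  then show ?thesis using assms by (simp add: key_val_eq)
qed simp

lemma key_val_exact_mono:
  assumes "i \<in> D" and "j \<in> D" and "i \<le> j" and "key_val i (to_rat f) = w (to_rat f)"
  shows "key_val j (to_rat f) = w (to_rat f)"
  using key_val_mono[OF assms(1-3), of f] key_val_le[OF assms(2), of f] assms(4) by simp

lemma complete_key_val:
  assumes "degree f > 0"
  shows "\<exists>i\<in>D. degree (Q i) \<le> degree f \<and> key_val i (to_rat f) = w (to_rat f)"
  using complete[OF assms] truncation_eq_aug[OF valuation_w value_key] by (auto simp: key_val_eq)

text \<open>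
  The inclusion of the value groups holds because a value of the truncation is the value of a single
  term \<open>g * Q i ^ k\<close> of an expansion, on which \<open>w2\<close> takes the same value.
\<close>

lemma val_le_of_powers:
  assumes "i \<in> D" and w2: "valuation w2" and le: "\<And>f. key_val i (to_rat f) \<le> w2 (to_rat f)"
    and low: "\<And>f. degree f < degree (Q i) \<Longrightarrow> w2 (to_rat f) = w (to_rat f)"
    and key: "w2 (to_rat (Q i)) = Fin (key_value i)"
  shows "val_le (key_val i) w2"
proof (rule val_leI)
  interpret w2: ring_valuation "\<lambda>f. w2 (to_rat f)" by (rule ring_valuation_to_rat[OF w2])
  fix f :: "'a poly"
  obtain k where "aug (\<lambda>f. w (to_rat f)) (Q i) (key_value i) f =
      w (to_rat (exp_coeff (Q i) f k)) + Fin (nmult k (key_value i))"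
    by (rule aug_attained)
  also have "\<dots> = w2 (to_rat (exp_coeff (Q i) f k * Q i ^ k))"
    using low degree_exp_coeff[OF degree_key[OF assms(1)]] w2.power_eq[OF key] by (simp add: w2.mult)
  finally show "\<exists>g. key_val i (to_rat f) = w2 (to_rat g)" using assms(1) by (metis key_val_eq)
qed (use assms valuation_key_val in auto)

lemma val_less_key_val:
  assumes "i \<in> D" and "j \<in> D" and "i < j"
  shows "val_less (key_val i) (key_val j)"
proof -
  have "val_le (key_val i) (key_val j)"
    using assms degree_mono[OF assms]
    by (intro val_le_of_powers) (auto simp: valuation_key_val key_val_mono key_val_low key_val_previous_key)
  moreover have "key_val i (to_rat (Q j)) < key_val j (to_rat (Q j))"
    using key_val_less_later_key[OF assms] assms by (simp add: key_val_key value_key)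
  ultimately show ?thesis by (auto simp: val_less_def)
qed

lemma val_less_key_val_w:
  assumes "i \<in> D" and "j \<in> D" and "i < j"
  shows "val_less (key_val i) w"
proof -
  have "val_le (key_val i) w"
    using assms by (intro val_le_of_powers) (auto simp: valuation_w key_val_le value_key)
  then show ?thesis using key_val_less_later_key[OF assms] by (auto simp: val_less_def)
qed

lemma ordinary_aug_key_val:
  assumes "i \<in> D" and "j \<in> D" and "i < j"
    and low: "\<And>f. degree f < degree (Q j) \<Longrightarrow> key_val i (to_rat f) = w (to_rat f)"
  shows "ordinary_aug (key_val i) (Q j) (key_value j) (key_val j)"
proof -
  have "Q j \<in> KP (key_val i)"
    using assms by (intro Phi_key_polynomial[where w = w])
      (auto simp: valuation_key_val valuation_w key_val_le monic_key degree_key key_val_less_later_key)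
  moreover have "key_val j (to_rat f) = aug (\<lambda>f. key_val i (to_rat f)) (Q j) (key_value j) f" for f
    unfolding key_val_eq[OF assms(2)] using low assms(2) by (intro aug_cong) (auto simp: degree_key)
  ultimately show ?thesis
    using assms key_val_less_later_key[OF assms(1-3)]
    by (simp add: ordinary_aug_def is_augmentation_iff valuation_key_val value_key)
qed

end

text \<open>
  A block of the sequence: \<open>b\<close> is its first index and \<open>S\<close> the set of its other indices.
\<close>

locale key_family = key_sequence w D Q
  for w :: "('a::field, 'g::linordered_ab_group_add) ratval"
    and D :: "'i::linorder set" and Q :: "'i \<Rightarrow> 'a poly" +
  fixes b :: 'i and S :: "'i set"
  assumes base: "b \<in> D" and members: "S \<subseteq> D" and nonempty: "S \<noteq> {}"
    and no_last: "i \<in> S \<Longrightarrow> \<exists>j\<in>S. i < j"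
    and after_base: "i \<in> S \<Longrightarrow> b < i"
    and same_degree: "i \<in> S \<Longrightarrow> degree (Q i) = degree (Q b)"
begin

text \<open>
  Continuous families inside limit augmentations are indexed by a set of elements of the value group;
  the values of the key polynomials increase strictly along \<open>S\<close> and serve as indices.
\<close>

definition index :: "'g \<Rightarrow> 'i" where
  "index = inv_into S key_value"

abbreviation key_values :: "'g set" where
  "key_values \<equiv> key_value ` S"

abbreviation family :: "'g \<Rightarrow> ('a, 'g) ratval" where
  "family \<equiv> \<lambda>a. key_val (index a)"

lemma index_mem: "a \<in> key_values \<Longrightarrow> index a \<in> S"
  and key_value_index: "a \<in> key_values \<Longrightarrow> key_value (index a) = a"
  by (simp_all add: index_def inv_into_into f_inv_into_f)

lemma in_D: "i \<in> S \<Longrightarrow> i \<in> D"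
  using members by auto

lemma index_key_value:
  assumes "i \<in> S"
  shows "index (key_value i) = i"
proof -
  have "inj_on key_value S"
  proof (rule linorder_inj_onI')
    fix i j assume ij: "i \<in> S" "j \<in> S" "i < j"
    show "key_value i \<noteq> key_value j"
      using key_value_less[OF in_D[OF ij(1)] in_D[OF ij(2)] ij(3)] by simp
  qed
  then show ?thesis unfolding index_def using assms by (rule inv_into_f_f)
qed

lemma index_le: 
  assumes "a \<in> key_values" and "i \<in> S" and "key_value i \<le> a"
  shows "i \<le> index a"
proof (rule ccontr)
  assume "\<not> i \<le> index a"
  then have "key_value (index a) < key_value i"
    using key_value_less[OF in_D[OF index_mem[OF assms(1)]] in_D[OF assms(2)]] by simp
  then show False using assms(3) key_value_index[OF assms(1)] by simp
qed

lemma index_less: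
  assumes "a \<in> key_values" and "a' \<in> key_values" and "a < a'"
  shows "index a < index a'"
proof -
  have "index a \<le> index a'"
    using assms index_le[OF assms(2) index_mem[OF assms(1)]] key_value_index[OF assms(1)] by simp
  moreover have "key_value (index a) \<noteq> key_value (index a')"
    unfolding key_value_index[OF assms(1)] key_value_index[OF assms(2)] using assms(3) by simp
  ultimately show ?thesis by (metis order.order_iff_strict)
qed

lemma ordinary_aug_member:
  assumes "i = b \<or> i \<in> S" and "j \<in> S" and "i < j"
  shows "ordinary_aug (key_val i) (Q j) (key_value j) (key_val j)"
proof (rule ordinary_aug_key_val)
  show "i \<in> D" "j \<in> D" "i < j" using assms base in_D by blast+
  have "degree (Q i) = degree (Q j)" using assms(1,2) same_degree by fastforce
  then show "key_val i (to_rat f) = w (to_rat f)" if "degree f < degree (Q j)" for f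
    using that \<open>i \<in> D\<close> by (simp add: key_val_low)
qed

text \<open>
  Members are not equivalent to earlier ones, because the difference of two of them has the value that
  the earlier valuation gives to both.
\<close>

lemma continuous_family:
  "continuous_family (key_val b) (degree (Q b)) key_values (\<lambda>a. Q (index a)) (\<lambda>a. a) family"
  unfolding continuous_family_def
proof (intro conjI ballI impI)
  show "key_values \<noteq> {}" using nonempty by simp
  show "\<exists>a'\<in>key_values. a < a'" if a: "a \<in> key_values" for a
  proof -
    obtain j where j: "j \<in> S" "index a < j" using no_last index_mem[OF a] by blast
    then have "key_value (index a) < key_value j"
      by (intro key_value_less in_D index_mem[OF a])
    then show ?thesis using j(1) key_value_index[OF a] by auto
  qed
  show "ordinary_aug (key_val b) (Q (index a)) a (family a)" if "a \<in> key_values" for a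
    using ordinary_aug_member[of b "index a"] index_mem[OF that] after_base[OF index_mem[OF that]]
      key_value_index[OF that] by simp
  show "degree (Q (index a)) = degree (Q b)" if "a \<in> key_values" for a
    using same_degree index_mem[OF that] by simp
  fix a a' assume a: "a \<in> key_values" "a' \<in> key_values" "a < a'"
  define i j where "i = index a" and "j = index a'"
  have ij: "i \<in> S" "j \<in> S" "i < j" unfolding i_def j_def by (intro index_mem index_less a)+
  have vals: "key_value i = a" "key_value j = a'" unfolding i_def j_def by (intro key_value_index a)+
  show "ordinary_aug (key_val i) (Q j) a' (key_val j)"
    using ordinary_aug_member[of i j] ij vals by simp
  have "degree (Q j - Q i) < degree (Q i)"
    using ij same_degree[OF ij(1)] same_degree[OF ij(2)] by (intro degree_key_diff in_D) simp_all
  then have "key_val i (to_rat (Q j - Q i)) = Fin a"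
    using value_key_diff[of i j] in_D[OF ij(1)] in_D[OF ij(2)] ij(3) vals w.diff_commute[of "Q j" "Q i"]
    by (simp add: key_val_low)
  moreover have "key_val i (to_rat (Q j)) = Fin a"
    using key_val_next_key[of i j] in_D[OF ij(1)] in_D[OF ij(2)] ij same_degree vals by simp
  ultimately show "\<not> val_equiv (key_val i) (Q j) (Q i)" by (simp add: val_equiv_def)
qed

lemma family_exact:
  assumes "i \<in> D" and "key_val i (to_rat f) = w (to_rat f)" and "s \<in> S" and "i \<le> s"
  shows "stable key_values family f" and "stable_value key_values family f = w (to_rat f)"
proof -
  have "family a (to_rat f) = w (to_rat f)" if "a \<in> key_values" "key_value s \<le> a" for a
    using index_le[OF that(1) assms(3) that(2)] assms(1,2,4) in_D[OF index_mem[OF that(1)]]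
    by (intro key_val_exact_mono[of i "index a" f]) auto
  note exact = stable_valueI[of "key_value s" key_values family f, OF _ this]
  show "stable key_values family f" "stable_value key_values family f = w (to_rat f)"
    using assms(3) by (auto intro: exact)
qed

text \<open>
  For \<open>p < q\<close> in \<open>S\<close>, the polynomial \<open>Q q\<close> is of minimal degree among those whose value increases
  from the \<open>p\<close>-th truncation to the \<open>q\<close>-th, and likewise among those whose value increases from the
  \<open>p\<close>-th truncation to \<open>w\<close>. So both increases are equivalent to divisibility by \<open>Q q\<close>, and
  a polynomial that never reaches its value under \<open>w\<close> increases in value at every step.
\<close>

lemma unstable_later_key:
  assumes "j \<in> D" and after: "\<And>i. i \<in> S \<Longrightarrow> i < j"
  shows "\<not> stable key_values family (Q j)"
proof
  assume "stable key_values family (Q j)"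
  then obtain a where a: "a \<in> key_values" "\<forall>a'\<in>key_values. a \<le> a' \<longrightarrow> family a' (to_rat (Q j)) = family a (to_rat (Q j))"
    by (auto simp: stable_def)
  define p where "p = index a"
  have p: "p \<in> S" "key_value p = a" unfolding p_def by (rule index_mem[OF a(1)], rule key_value_index[OF a(1)])
  obtain q where q: "q \<in> S" "p < q" using no_last[OF p(1)] by blast
  note D = in_D[OF p(1)] in_D[OF q(1)]
  have "key_val q (to_rat (Q j)) = key_val p (to_rat (Q j))"
    using a(2) q p key_value_less[OF D q(2)] index_key_value[OF q(1)] by (auto simp: p_def)
  have deg: "degree (Q p) = degree (Q q)" using same_degree p q by simp
  have less: "key_val p (to_rat (Q j)) < w (to_rat (Q j))"
    using key_val_less_later_key[of p j] D after[OF p(1)] assms(1) by simp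
  have "val_dvd (key_val p) (Q q) (Q j) \<longleftrightarrow> key_val p (to_rat (Q j)) < w (to_rat (Q j))"
    using D q(2) deg
    by (intro val_dvd_iff_less)
       (auto simp: valuation_key_val valuation_w key_val_le monic_key degree_key key_val_less_later_key key_val_low)
  moreover have "val_dvd (key_val p) (Q q) (Q j) \<longleftrightarrow> key_val p (to_rat (Q j)) < key_val q (to_rat (Q j))"
    using D q(2) deg key_val_less_later_key[of p q]
    by (intro val_dvd_iff_less)
       (auto simp: valuation_key_val key_val_mono monic_key degree_key key_val_low key_val_key value_key)
  ultimately show False using less \<open>key_val q _ = _\<close> by simp
qed

lemma limit_aug_key_val:
  assumes j: "j \<in> D" and after: "\<And>i. i \<in> S \<Longrightarrow> i < j" and deg: "degree (Q b) < degree (Q j)"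
    and low: "\<And>f. 0 < degree f \<Longrightarrow> degree f < degree (Q j) \<Longrightarrow>
      \<exists>i\<in>D. \<exists>s\<in>S. i \<le> s \<and> key_val i (to_rat f) = w (to_rat f)"
  shows "limit_aug (key_val b) (Q j) (key_value j) (key_val j)"
proof -
  have exact: "stable key_values family f \<and> stable_value key_values family f = w (to_rat f)"
    if less: "degree f < degree (Q j)" for f
  proof (cases "degree f = 0")
    case True
    obtain s where s: "s \<in> S" using nonempty by blast
    then show ?thesis
      using family_exact[of b f s] base key_val_low[OF base, of f] degree_key[OF base]
        less_imp_le[OF after_base[OF s]] True by simp
  next
    case False
    then obtain i s where "i \<in> D" "s \<in> S" "i \<le> s" "key_val i (to_rat f) = w (to_rat f)"
      using low[of f] less by blast
    then show ?thesis using family_exact by simp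
  qed
  have unstable: "\<not> stable key_values family (Q j)" by (rule unstable_later_key) fact+
  have m_inf: "m_inf key_values family = enat (degree (Q j))"
    unfolding m_inf_def
  proof (rule antisym)
    show "(INF f\<in>{f. \<not> stable key_values family f}. enat (degree f)) \<le> enat (degree (Q j))"
      using unstable by (intro INF_lower) simp
    show "enat (degree (Q j)) \<le> (INF f\<in>{f. \<not> stable key_values family f}. enat (degree f))"
      using exact by (intro INF_greatest) (auto simp: not_less[symmetric])
  qed
  have "Q j \<in> KP_inf key_values family" using unstable monic_key[OF j] by (simp add: KP_inf_def m_inf)
  moreover have "family a (to_rat (Q j)) < Fin (key_value j)" if "a \<in> key_values" for a
    using key_val_less_later_key[of "index a" j] index_mem[OF that] in_D j after by (simp add: value_key)
  moreover have "is_augmentation (stable_value key_values family) (Q j) (key_value j) (key_val j)"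
    unfolding is_augmentation_iff
  proof (intro conjI allI)
    show "valuation (key_val j)" by (rule valuation_key_val) fact
    show "key_val j (to_rat f) = aug (stable_value key_values family) (Q j) (key_value j) f" for f
      unfolding key_val_eq[OF j] using exact degree_key[OF j] by (intro aug_cong) auto
  qed
  moreover have "enat (degree (Q b)) < m_inf key_values family" "m_inf key_values family < \<infinity>"
    using deg m_inf by simp_all
  ultimately show ?thesis
    unfolding limit_aug_def using continuous_family by blast
qed

lemma Phi_base:
  assumes low: "\<And>f. degree f < degree (Q b) \<Longrightarrow> w2 (to_rat f) = w (to_rat f)"
    and keys: "\<And>i. i = b \<or> i \<in> S \<Longrightarrow> w2 (to_rat (Q i)) = w (to_rat (Q i))"
  shows "deg_Phi (key_val b) w2 = degree (Q b)" and "Q b \<notin> Phi (key_val b) w2"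
proof -
  obtain s where s: "s \<in> S" using nonempty by blast
  show "deg_Phi (key_val b) w2 = degree (Q b)"
  proof (rule deg_Phi_eqI)
    show "lead_coeff (Q s) = 1" using s in_D monic_key by blast
    show "key_val b (to_rat (Q s)) < w2 (to_rat (Q s))"
      using s keys key_val_less_later_key[of b s] base in_D after_base by simp
    show "degree (Q s) = degree (Q b)" by (rule same_degree) fact
    show "key_val b (to_rat f) = w2 (to_rat f)" if "degree f < degree (Q b)" for f
      using low that base by (simp add: key_val_low)
  qed
  show "Q b \<notin> Phi (key_val b) w2"
    using keys[of b] base by (simp add: Phi_def key_val_key value_key)
qed

lemma limit_of_family:
  assumes "\<And>i. i \<in> D \<Longrightarrow> \<exists>s\<in>S. i \<le> s"
  shows "limit_of_continuous_family (key_val b) w"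
proof -
  have "stable key_values family f \<and> w (to_rat f) = stable_value key_values family f" for f
  proof -
    have "\<exists>i\<in>D. key_val i (to_rat f) = w (to_rat f)"
      using complete_key_val[of f] base key_val_low[OF base, of f] degree_key[OF base]
      by (cases "degree f = 0") auto
    then obtain i where i: "i \<in> D" "key_val i (to_rat f) = w (to_rat f)" by blast
    obtain s where s: "s \<in> S" "i \<le> s" using assms i(1) by blast
    show ?thesis using family_exact[OF i s] by simp
  qed
  then show ?thesis
    unfolding limit_of_continuous_family_def stable_limit_def
    using continuous_family valuation_w by blast
qed

end

section \<open>The chain of an induced complete sequence\<close>

locale induced_key_sequence = key_sequence w D Q
  for w :: "('a::field, 'g::linordered_ab_group_add) ratval"
    and D :: "'i::linorder set" and Q :: "'i \<Rightarrow> 'a poly" +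
  fixes I :: "nat set" and c :: "nat \<Rightarrow> 'i" and \<theta> :: "nat \<Rightarrow> 'i set"
  assumes I_cases: "I = UNIV \<or> (\<exists>N. I = {..N})"
    and c_mono: "strict_mono_on I c"
    and D_eq: "D = (\<Union>j\<in>I. block c \<theta> j)"
    and limit_no_last: "j \<in> I \<Longrightarrow> i \<in> \<theta> j \<Longrightarrow> \<exists>i'\<in>\<theta> j. i < i'"
    and degree_first: "degree (Q (c 0)) = 1"
    and between: "Suc j \<in> I \<Longrightarrow> i \<in> \<theta> j \<Longrightarrow> c j < i \<and> i < c (Suc j)"
    and after_last: "I = {..N} \<Longrightarrow> i \<in> \<theta> N \<Longrightarrow> c N < i"
    and block_degree: "j \<in> I \<Longrightarrow> i \<in> block c \<theta> j \<Longrightarrow> i' \<in> block c \<theta> j \<Longrightarrow>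
      degree (Q i) = degree (Q i')"
    and next_degree: "Suc j \<in> I \<Longrightarrow> i \<in> block c \<theta> j \<Longrightarrow> i' \<in> block c \<theta> (Suc j) \<Longrightarrow>
      degree (Q i) < degree (Q i')"
    and no_max: "\<not> (\<exists>m\<in>D. \<forall>i\<in>D. i \<le> m)"
begin

abbreviation chain :: "nat \<Rightarrow> ('a, 'g) ratval" where
  "chain n \<equiv> key_val (c n)"

abbreviation chain_key :: "nat \<Rightarrow> 'a poly" where
  "chain_key n \<equiv> Q (c n)"

abbreviation chain_value :: "nat \<Rightarrow> 'g" where
  "chain_value n \<equiv> key_value (c n)"

lemma I_downward: "n \<in> I \<Longrightarrow> m \<le> n \<Longrightarrow> m \<in> I"
  using I_cases by auto

lemma zero_in_I: "0 \<in> I"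
  using I_cases by auto

lemma c_in_D: "n \<in> I \<Longrightarrow> c n \<in> D"
  and limit_in_D: "n \<in> I \<Longrightarrow> \<theta> n \<subseteq> D"
  by (auto simp: D_eq block_def)

lemma c_le: "n \<in> I \<Longrightarrow> m \<le> n \<Longrightarrow> c m \<le> c n"
  using c_mono I_downward[of n m] by (cases "m = n") (auto simp: strict_mono_on_def intro: less_imp_le)

lemma c_less_Suc: "Suc n \<in> I \<Longrightarrow> c n < c (Suc n)"
  using c_mono I_downward[of "Suc n" n] by (simp add: strict_mono_on_def)

lemma after_c: 
  assumes "n \<in> I" and "i \<in> \<theta> n"
  shows "c n < i"
proof (cases "Suc n \<in> I")
  case False
  then have "I = {..n}" using I_cases assms(1) by (auto simp: not_le)
  then show ?thesis using after_last assms(2) by blast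
qed (use between assms(2) in blast)

lemma block_ge: "n \<in> I \<Longrightarrow> i \<in> block c \<theta> n \<Longrightarrow> c n \<le> i"
  using after_c by (auto simp: block_def intro: less_imp_le)

lemma block_less_next:
  assumes "Suc n \<in> I" and "m \<le> n" and "i \<in> block c \<theta> m"
  shows "i < c (Suc n)"
proof -
  have m: "Suc m \<in> I" by (rule I_downward[OF assms(1)]) (use assms(2) in simp)
  have "i < c (Suc m)" using assms(3) between[OF m] c_less_Suc[OF m] by (auto simp: block_def)
  also have "\<dots> \<le> c (Suc n)" using assms by (intro c_le) auto
  finally show ?thesis .
qed

lemma chain_degree_less: "Suc n \<in> I \<Longrightarrow> degree (chain_key n) < degree (chain_key (Suc n))"
  by (rule next_degree) (auto simp: block_def)

lemma family_locale:
  assumes "n \<in> I" and "\<theta> n \<noteq> {}"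
  shows "key_family w D Q (c n) (\<theta> n)"
proof
  show "c n \<in> D" "\<theta> n \<subseteq> D" "\<theta> n \<noteq> {}" using assms c_in_D limit_in_D by blast+
  fix i assume i: "i \<in> \<theta> n"
  show "\<exists>j\<in>\<theta> n. i < j" by (rule limit_no_last) fact+
  show "c n < i" by (rule after_c) fact+
  show "degree (Q i) = degree (chain_key n)"
    using i by (intro block_degree[OF assms(1)]) (auto simp: block_def)
qed

text \<open>
  Completeness yields an index whose key polynomial has degree at most \<open>degree f\<close>; the jump of the
  degrees between blocks places it in block \<open>n\<close> or earlier.
\<close>

lemma exact_before_next:
  assumes n: "Suc n \<in> I" and f: "0 < degree f" "degree f < degree (chain_key (Suc n))"
  obtains i where "i \<in> D" "key_val i (to_rat f) = w (to_rat f)" "i \<le> c n \<or> i \<in> \<theta> n"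
proof -
  obtain i where i: "i \<in> D" "degree (Q i) \<le> degree f" "key_val i (to_rat f) = w (to_rat f)"
    using complete_key_val[OF f(1)] by blast
  obtain m where m: "m \<in> I" "i \<in> block c \<theta> m" using i(1) by (auto simp: D_eq)
  have "m \<le> n"
  proof (rule ccontr)
    assume "\<not> m \<le> n"
    then have "c (Suc n) \<le> i" using c_le[OF m(1), of "Suc n"] block_ge[OF m] by simp
    then have "degree (chain_key (Suc n)) \<le> degree (Q i)"
      using degree_mono[OF c_in_D[OF n] i(1)] by (cases "c (Suc n) = i") auto
    then show False using i(2) f(2) by simp
  qed
  have "i \<le> c n \<or> i \<in> \<theta> n"
  proof (cases "m = n")
    case False
    then obtain k where k: "n = Suc k" "m \<le> k" using \<open>m \<le> n\<close> by (cases n) auto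
    then have "i < c n" using block_less_next[of k m i] m(2) I_downward[OF n, of n] by simp
    then show ?thesis by (simp add: less_imp_le)
  qed (use m(2) in \<open>auto simp: block_def\<close>)
  then show ?thesis using that i by blast
qed

lemma ordinary_step:
  assumes n: "Suc n \<in> I" and "\<theta> n = {}"
  shows "ordinary_aug (chain n) (chain_key (Suc n)) (chain_value (Suc n)) (chain (Suc n))"
    and "deg_Phi (chain n) (chain (Suc n)) = degree (chain_key (Suc n))"
proof -
  have D: "c n \<in> D" "c (Suc n) \<in> D" using n I_downward[OF n, of n] c_in_D by auto
  have low: "chain n (to_rat f) = w (to_rat f)" if f: "degree f < degree (chain_key (Suc n))" for f
  proof (cases "degree f = 0")
    case True
    then show ?thesis using D degree_key by (simp add: key_val_low)
  next
    case False
    then obtain i where "i \<in> D" "key_val i (to_rat f) = w (to_rat f)" "i \<le> c n"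
      using exact_before_next[OF n _ f] assms(2) by blast
    then show ?thesis using key_val_exact_mono D(1) by blast
  qed
  show "ordinary_aug (chain n) (chain_key (Suc n)) (chain_value (Suc n)) (chain (Suc n))"
    by (rule ordinary_aug_key_val[OF D c_less_Suc[OF n] low])
  show "deg_Phi (chain n) (chain (Suc n)) = degree (chain_key (Suc n))"
  proof (rule deg_Phi_eqI[OF _ _ refl])
    show "lead_coeff (chain_key (Suc n)) = 1" by (rule monic_key[OF D(2)])
    show "chain n (to_rat (chain_key (Suc n))) < chain (Suc n) (to_rat (chain_key (Suc n)))"
      using key_val_less_later_key[OF D c_less_Suc[OF n]] by (simp add: key_val_key value_key D)
    show "chain n (to_rat f) = chain (Suc n) (to_rat f)" if "degree f < degree (chain_key (Suc n))" for f
      using low that D by (simp add: key_val_low)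
  qed
qed

lemma limit_step:
  assumes n: "Suc n \<in> I" and "\<theta> n \<noteq> {}"
  shows "limit_aug (chain n) (chain_key (Suc n)) (chain_value (Suc n)) (chain (Suc n))"
    and "deg_Phi (chain n) (chain (Suc n)) = degree (chain_key n)"
    and "chain_key n \<notin> Phi (chain n) (chain (Suc n))"
proof -
  have n': "n \<in> I" by (rule I_downward[OF n]) simp
  have D: "c n \<in> D" "c (Suc n) \<in> D" using n n' c_in_D by auto
  interpret key_family w D Q "c n" "\<theta> n" by (rule family_locale) fact+
  show "limit_aug (chain n) (chain_key (Suc n)) (chain_value (Suc n)) (chain (Suc n))"
  proof (rule limit_aug_key_val[OF D(2)])
    show "i < c (Suc n)" if "i \<in> \<theta> n" for i using between[OF n that] by simp
    show "degree (chain_key n) < degree (chain_key (Suc n))" by (rule chain_degree_less) fact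
    fix f :: "'a poly"
    assume f: "0 < degree f" "degree f < degree (chain_key (Suc n))"
    obtain i where i: "i \<in> D" "key_val i (to_rat f) = w (to_rat f)" "i \<le> c n \<or> i \<in> \<theta> n"
      by (rule exact_before_next[OF n f])
    obtain s where s: "s \<in> \<theta> n" using assms(2) by blast
    have "\<exists>s\<in>\<theta> n. i \<le> s"
    proof (cases "i \<in> \<theta> n")
      case False
      then have "i \<le> s" using i(3) after_base[OF s] by simp
      then show ?thesis using s by blast
    qed blast
    then show "\<exists>i\<in>D. \<exists>s\<in>\<theta> n. i \<le> s \<and> key_val i (to_rat f) = w (to_rat f)"
      using i(1,2) by blast
  qed
  have low: "chain (Suc n) (to_rat f) = w (to_rat f)" if "degree f \<le> degree (chain_key n)" for f
    using that chain_degree_less[OF n] D by (intro key_val_low) auto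
  have keys: "degree (Q i) \<le> degree (chain_key n)" if "i = c n \<or> i \<in> \<theta> n" for i
    using that same_degree[of i] by auto
  show "deg_Phi (chain n) (chain (Suc n)) = degree (chain_key n)"
    and "chain_key n \<notin> Phi (chain n) (chain (Suc n))"
    by (rule Phi_base; intro low keys; simp)+
qed

lemma ordinary_iff:
  assumes "Suc n \<in> I"
  shows "ordinary_aug (chain n) (chain_key (Suc n)) (chain_value (Suc n)) (chain (Suc n)) \<longleftrightarrow> \<theta> n = {}"
  using ordinary_step(1)[OF assms] limit_step(1)[OF assms] ordinary_aug_not_limit_aug by blast

lemma MLV_chain: "MLV_chain I chain_key chain_value chain"
  unfolding MLV_chain_def augmentation_chain_def
proof (intro conjI allI impI)
  fix n assume n: "Suc n \<in> I"
  have n': "n \<in> I" by (rule I_downward[OF n]) simp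
  have D: "c n \<in> D" "c (Suc n) \<in> D" using n n' c_in_D by auto
  show "ordinary_aug (chain n) (chain_key (Suc n)) (chain_value (Suc n)) (chain (Suc n)) \<or>
      limit_aug (chain n) (chain_key (Suc n)) (chain_value (Suc n)) (chain (Suc n))"
    using ordinary_step(1)[OF n] limit_step(1)[OF n] by blast
  show "val_less (chain n) (chain (Suc n))" by (rule val_less_key_val[OF D c_less_Suc[OF n]])
  show "deg_val (chain n) < deg_Phi (chain n) (chain (Suc n))"
    if "ordinary_aug (chain n) (chain_key (Suc n)) (chain_value (Suc n)) (chain (Suc n))"
    using that ordinary_iff[OF n] ordinary_step(2)[OF n] chain_degree_less[OF n] D
    by (simp add: deg_key_val)
  assume "limit_aug (chain n) (chain_key (Suc n)) (chain_value (Suc n)) (chain (Suc n))"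
  then have "\<theta> n \<noteq> {}" using ordinary_iff[OF n] ordinary_aug_not_limit_aug by blast
  then show "deg_val (chain n) = deg_Phi (chain n) (chain (Suc n))"
    and "chain_key n \<notin> Phi (chain n) (chain (Suc n))"
    using limit_step(2,3)[OF n] D by (simp_all add: deg_key_val)
qed (simp_all add: key_val_KP deg_key_val key_val_key c_in_D zero_in_I)

lemma depth_zero_first:
  assumes "extends_to_rat v w"
  shows "depth_zero v (chain 0)"
proof -
  have D: "c 0 \<in> D" by (rule c_in_D[OF zero_in_I])
  define \<alpha> where "\<alpha> = - coeff (chain_key 0) 0"
  have X: "chain_key 0 = [:- \<alpha>, 1:]"
    using degree_first monic_key[OF D]
    by (cases "chain_key 0" rule: pCons_cases) (auto simp: \<alpha>_def elim!: degree_eq_zeroE split: if_splits)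
  have "chain 0 (to_rat (\<Sum>i\<le>n. smult (a i) ([:- \<alpha>, 1:] ^ i))) =
      Min ((\<lambda>i. v (a i) + Fin (nmult i (chain_value 0))) ` {..n})" for n a
  proof -
    define f where "f = (\<Sum>i\<le>n. smult (a i) ([:- \<alpha>, 1:] ^ i))"
    \<comment> \<open>The degree of \<open>f\<close> may differ from \<open>n\<close>, so the digits are extended by 0 to all indices.\<close>
    define a' where "a' i = (if i \<le> n then a i else 0)" for i
    have digit: "exp_coeff (chain_key 0) f i = [:a' i:]" for i
    proof (rule expansion_unique)
      have "f = (\<Sum>j\<le>n. [:a' j:] * chain_key 0 ^ j)"
        unfolding f_def X by (intro sum.cong) (auto simp: a'_def)
      also have "\<dots> = (\<Sum>j\<le>max n i. [:a' j:] * chain_key 0 ^ j)"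
        by (intro sum.mono_neutral_left) (auto simp: a'_def)
      finally show "f = (\<Sum>j\<le>max n i. [:a' j:] * chain_key 0 ^ j)" .
    qed (auto simp: degree_first)
    have w_const: "w (to_rat [:b:]) = v b" for b using assms by (simp add: extends_to_rat_def)
    have v0: "v 0 = Pinf" using w_const[of 0] w.zero by simp
    have *: "x \<le> chain 0 (to_rat f) \<longleftrightarrow>
        x \<le> Min ((\<lambda>i. v (a i) + Fin (nmult i (chain_value 0))) ` {..n})" for x
    proof -
      have "x \<le> chain 0 (to_rat f) \<longleftrightarrow> (\<forall>i. x \<le> v (a' i) + Fin (nmult i (chain_value 0)))"
        unfolding key_val_eq[OF D] using le_aug_iff[of "\<lambda>f. w (to_rat f)" "chain_key 0"]
        by (simp add: degree_first digit w_const)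
      also have "\<dots> \<longleftrightarrow> (\<forall>i\<le>n. x \<le> v (a i) + Fin (nmult i (chain_value 0)))"
        by (auto simp: a'_def v0)
      also have "\<dots> \<longleftrightarrow> x \<le> Min ((\<lambda>i. v (a i) + Fin (nmult i (chain_value 0))) ` {..n})"
        by (subst Min_ge_iff) auto
      finally show ?thesis .
    qed
    show ?thesis unfolding f_def[symmetric] by (rule antisym) (use * in blast)+
  qed
  then show ?thesis unfolding depth_zero_def using valuation_key_val[OF D] by blast
qed

lemma exact_somewhere: "\<exists>i\<in>D. key_val i (to_rat f) = w (to_rat f)"
proof (cases "degree f = 0")
  case True
  have "c 0 \<in> D" by (rule c_in_D[OF zero_in_I])
  then show ?thesis using True degree_first key_val_low[of "c 0" f] by auto
qed (use complete_key_val in blast)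

lemma stable_limit_chain:
  assumes "I = UNIV"
  shows "stable_limit UNIV chain w"
proof -
  have "stable UNIV chain f \<and> stable_value UNIV chain f = w (to_rat f)" for f
  proof -
    obtain i where i: "i \<in> D" "key_val i (to_rat f) = w (to_rat f)" using exact_somewhere by blast
    obtain m where m: "i \<in> block c \<theta> m" using i(1) by (auto simp: D_eq)
    have "chain n (to_rat f) = w (to_rat f)" if n: "Suc m \<le> n" for n
    proof -
      have "i < c (Suc m)" using block_less_next[of m m i] m assms by simp
      also have "\<dots> \<le> c n" using c_le[of n "Suc m"] n assms by simp
      finally show ?thesis using key_val_exact_mono[of i "c n" f] i c_in_D[of n] assms by simp
    qed
    then show ?thesis using stable_valueI[of "Suc m" UNIV chain f "w (to_rat f)"] by blast
  qed
  then show ?thesis using valuation_w by (simp add: stable_limit_def)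
qed

text \<open>
  If \<open>\<theta> r\<close> were empty, then \<open>c r\<close> would be the last index.
\<close>

lemma last_block:
  assumes I: "I = {..r}"
  shows "\<theta> r \<noteq> {}" and "i \<in> D \<Longrightarrow> \<exists>s\<in>\<theta> r. i \<le> s"
proof -
  have r: "r \<in> I" using I by simp
  have cover: "i \<le> c r \<or> i \<in> \<theta> r" if i: "i \<in> D" for i
  proof -
    obtain m where m: "m \<in> I" "i \<in> block c \<theta> m" using i by (auto simp: D_eq)
    show ?thesis
    proof (cases "m = r")
      case False
      then obtain k where k: "r = Suc k" "m \<le> k" using m(1) I by (cases r) auto
      then have "i < c r" using block_less_next[of k m i] m(2) r by simp
      then show ?thesis by (simp add: less_imp_le)
    qed (use m(2) in \<open>auto simp: block_def\<close>)
  qed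
  show "\<theta> r \<noteq> {}" using cover no_max c_in_D[OF r] by blast
  then obtain s where s: "s \<in> \<theta> r" by blast
  show "\<exists>s\<in>\<theta> r. i \<le> s" if "i \<in> D"
    using cover[OF that] s after_c[OF r s] by (meson less_imp_le order_refl order_trans)
qed

lemma stable_limit_after_chain:
  assumes I: "I = {..r}"
  shows "stable_limit_after_finite_chain w r chain_key chain_value chain"
proof -
  have r: "r \<in> I" using I by simp
  interpret key_family w D Q "c r" "\<theta> r" by (rule family_locale[OF r last_block(1)[OF I]])
  obtain s where s: "s \<in> \<theta> r" using nonempty by blast
  have "limit_of_continuous_family (chain r) w" by (rule limit_of_family) (rule last_block(2)[OF I])
  moreover have "val_less (chain r) w"
    by (rule val_less_key_val_w[OF base in_D[OF s] after_base[OF s]])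
  moreover have "deg_Phi (chain r) w = deg_val (chain r)" and "chain_key r \<notin> Phi (chain r) w"
    using Phi_base[of w] base by (simp_all add: deg_key_val)
  ultimately show ?thesis
    using MLV_chain I by (simp add: stable_limit_after_finite_chain_def MLV_chain_def)
qed

lemma no_limit_of_continuous_family:
  assumes "I = UNIV"
  shows "\<not> limit_of_continuous_family w' w"
proof
  assume "limit_of_continuous_family w' w"
  then obtain m where m: "\<And>Q. strict_reduction (\<lambda>f. w (to_rat f)) Q \<Longrightarrow> degree Q \<le> m"
    using degree_le_of_limit_of_continuous_family by blast
  have "n < degree (chain_key n)" for n
  proof (induction n)
    case 0
    show ?case by (simp add: degree_first)
  next
    case (Suc n)
    have "Suc n \<in> I" using assms by simp
    from chain_degree_less[OF this] Suc show ?case by simp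
  qed
  moreover have "c m \<in> D" using assms by (simp add: c_in_D)
  then have "degree (chain_key m) \<le> m" by (rule m[OF strict])
  ultimately show False by (metis not_le)
qed

end

text \<open>
  The degrees increase weakly because the numbers \<open>delta\<close> increase strictly, and a key polynomial has a
  greater \<open>delta\<close> than all polynomials of smaller degree.
\<close>

lemma induced_key_sequence_of_induced_complete_seq:
  assumes v: "extends_to_rat v w" and ext: "common_extension vbar w wbar"
    and seq: "induced_complete_seq w wbar D Q I c \<theta>"
    and no_max: "\<not> (\<exists>m\<in>D. \<forall>i\<in>D. i \<le> m)"
  shows "induced_key_sequence w D Q I c \<theta>"
proof -
  have w: "valuation w" using v by (simp add: extends_to_rat_def)
  have complete: "complete_seq w wbar D Q" using seq unfolding induced_complete_seq_def by blast
  have abkp: "abkp wbar (Q i)" if "i \<in> D" for i using complete that by (simp add: complete_seq_def)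
  show ?thesis
  proof
    show "valuation w" by fact
    show "strict_reduction (\<lambda>f. w (to_rat f)) (Q i)" if "i \<in> D" for i
      by (rule strict_reduction_of_abkp[OF w ext abkp[OF that]])
    show "degree (Q i) \<le> degree (Q j)" if D: "i \<in> D" "j \<in> D" and "i < j" for i j
    proof (rule ccontr)
      assume "\<not> ?thesis"
      then have "delta wbar (Q j) < delta wbar (Q i)"
        using abkp[OF D(1)] abkp[OF D(2)] by (simp add: abkp_def)
      moreover have "delta wbar (Q i) < delta wbar (Q j)"
        using complete D \<open>i < j\<close> by (simp add: complete_seq_def)
      ultimately show False by simp
    qed
    show "w (to_rat (Q i)) < w (to_rat (Q j))" if "i \<in> D" "j \<in> D" "i < j" for i j
      using seq that unfolding induced_complete_seq_def by blast
    show "\<exists>i\<in>D. degree (Q i) \<le> degree f \<and> truncation w (Q i) f = w (to_rat f)"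
      if "degree f > 0" for f
      using complete that by (simp add: complete_seq_def)
    show "degree (Q (c 0)) = 1" using seq unfolding induced_complete_seq_def by blast
    show "I = UNIV \<or> (\<exists>N. I = {..N})"
      using seq unfolding induced_complete_seq_def by blast
    show "strict_mono_on I c" using seq unfolding induced_complete_seq_def by blast
    show "D = (\<Union>j\<in>I. block c \<theta> j)" using seq unfolding induced_complete_seq_def by (elim conjE)
    have "\<forall>j\<in>I. \<forall>i\<in>\<theta> j. \<exists>i'\<in>\<theta> j. i < i'"
      using seq unfolding induced_complete_seq_def by (elim conjE)
    then show "\<exists>i'\<in>\<theta> j. i < i'"
      if "j \<in> I" "i \<in> \<theta> j" for j i
      using that by blast
    have "\<forall>j. Suc j \<in> I \<longrightarrow> (\<forall>i\<in>\<theta> j. c j < i \<and> i < c (Suc j))"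
      using seq unfolding induced_complete_seq_def by (elim conjE)
    then show "c j < i \<and> i < c (Suc j)"
      if "Suc j \<in> I" "i \<in> \<theta> j" for j i
      using that by blast
    have "\<forall>N. I = {..N} \<longrightarrow> (\<forall>i\<in>\<theta> N. c N < i)"
      using seq unfolding induced_complete_seq_def by (elim conjE)
    then show "c N < i"
      if "I = {..N}" "i \<in> \<theta> N" for N i
      using that by blast
    have "\<forall>j\<in>I. \<forall>i\<in>block c \<theta> j. \<forall>i'\<in>block c \<theta> j. degree (Q i) = degree (Q i')"
      using seq unfolding induced_complete_seq_def by (elim conjE)
    then show "degree (Q i) = degree (Q i')"
      if "j \<in> I" "i \<in> block c \<theta> j" "i' \<in> block c \<theta> j" for j i i'
      using that by blast
    have "\<forall>j. Suc j \<in> I \<longrightarrow> (\<forall>i\<in>block c \<theta> j. \<forall>i'\<in>block c \<theta> (Suc j). degree (Q i) < degree (Q i'))"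
      using seq unfolding induced_complete_seq_def by (elim conjE)
    then show "degree (Q i) < degree (Q i')"
      if "Suc j \<in> I" "i \<in> block c \<theta> j" "i' \<in> block c \<theta> (Suc j)" for j i i'
      using that by blast
    show "\<not> (\<exists>m\<in>D. \<forall>i\<in>D. i \<le> m)" by fact
  qed
qed

theorem theorem2p20:
  fixes v :: "'a::field \<Rightarrow> 'g::linordered_ab_group_add extended"
    and vbar :: "'a alg_closure \<Rightarrow> 'g extended"
    and w :: "('a, 'g) ratval"
    and wbar :: "('a alg_closure, 'g) ratval"
    and Q :: "'i::linorder \<Rightarrow> 'a poly"
    and D :: "'i set" and I :: "nat set"
    and c :: "nat \<Rightarrow> 'i" and \<theta> :: "nat \<Rightarrow> 'i set"
  assumes "valuation v"
    and "valuation vbar" and "\<And>a. vbar (to_ac a) = v a"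
    and "extends_to_rat v w"
    and "common_extension vbar w wbar"
    and "induced_complete_seq w wbar D Q I c \<theta>"
    and "\<not> (\<exists>m\<in>D. \<forall>i\<in>D. i \<le> m)"
  shows
    "((\<exists>r \<gamma> ws. I = {..r} \<and>
          stable_limit_after_finite_chain w r (\<lambda>j. Q (c j)) \<gamma> ws \<and>
          complete_MLV_chain v {..r} (\<lambda>j. Q (c j)) \<gamma> ws \<and>
          (\<forall>j\<in>I. Fin (\<gamma> j) = w (to_rat (Q (c j)))) \<and>
          (\<forall>j. Suc j \<in> I \<longrightarrow>
            (ordinary_aug (ws j) (Q (c (Suc j))) (\<gamma> (Suc j)) (ws (Suc j)) \<longleftrightarrow> \<theta> j = {})))
      \<or> (\<exists>\<gamma> ws. I = UNIV \<and>
          stable_limit_of_infinite_chain v w (\<lambda>j. Q (c j)) \<gamma> ws \<and>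
          (\<forall>j\<in>I. Fin (\<gamma> j) = w (to_rat (Q (c j)))) \<and>
          (\<forall>j. Suc j \<in> I \<longrightarrow>
            (ordinary_aug (ws j) (Q (c (Suc j))) (\<gamma> (Suc j)) (ws (Suc j)) \<longleftrightarrow> \<theta> j = {}))))
     \<and> \<not> ((\<exists>r \<gamma> ws. r \<in> I \<and> stable_limit_after_finite_chain w r (\<lambda>j. Q (c j)) \<gamma> ws) \<and>
          (\<exists>\<gamma> ws. I = UNIV \<and> stable_limit_of_infinite_chain v w (\<lambda>j. Q (c j)) \<gamma> ws))"
proof -
  interpret induced_key_sequence w D Q I c \<theta>
    using assms(4-7) by (rule induced_key_sequence_of_induced_complete_seq)
  have depth: "depth_zero v (chain 0)" by (rule depth_zero_first) fact
  then have MLV: "complete_MLV_chain v I chain_key chain_value chain"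
    using MLV_chain by (simp add: complete_MLV_chain_def)
  have key_values: "\<forall>j\<in>I. Fin (chain_value j) = w (to_rat (chain_key j))"
    by (simp add: value_key c_in_D)
  have steps: "\<forall>j. Suc j \<in> I \<longrightarrow>
      (ordinary_aug (chain j) (chain_key (Suc j)) (chain_value (Suc j)) (chain (Suc j)) \<longleftrightarrow> \<theta> j = {})"
    using ordinary_iff by blast
  have exclusive: "\<not> ((\<exists>r \<gamma> ws. r \<in> I \<and> stable_limit_after_finite_chain w r chain_key \<gamma> ws) \<and>
      (\<exists>\<gamma> ws. I = UNIV \<and> stable_limit_of_infinite_chain v w chain_key \<gamma> ws))"
    unfolding stable_limit_after_finite_chain_def using no_limit_of_continuous_family by blast
  consider (finite) r where "I = {..r}" | (infinite) "I = UNIV" using I_cases by blast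
  then show ?thesis
  proof cases
    case finite
    have limit: "stable_limit_after_finite_chain w r chain_key chain_value chain"
      by (rule stable_limit_after_chain) fact
    have MLV_r: "complete_MLV_chain v {..r} chain_key chain_value chain" using MLV finite by simp
    show ?thesis
      by (intro conjI[OF _ exclusive] disjI1 exI[of _ r] exI[of _ chain_value] exI[of _ chain] conjI
          finite limit MLV_r key_values steps)
  next
    case infinite
    have limit: "stable_limit_of_infinite_chain v w chain_key chain_value chain"
      using MLV stable_limit_chain[OF infinite] infinite
      by (simp add: stable_limit_of_infinite_chain_def)
    show ?thesis
      by (intro conjI[OF _ exclusive] disjI2 exI[of _ chain_value] exI[of _ chain] conjI
          infinite limit key_values steps)
  qed
qed

end
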